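(* Let $\mathcal{T}_m$ be a spherically homogeneous rooted tree with branching sequence $m=(m_n)_{n\in\mathbb{N}}$ in $\mathbb{N}_{\ge2}$. Let $G\le\mathrm{Aut}(\mathcal{T}_m)$ be a closed subgroup acting distance-transitively on the boundary $\partial\mathcal{T}_m$, and let $P=P_\xi\le G$ be the stabiliser of a point $\xi\in\partial\mathcal{T}_m$. Then the induced representation $\rho_\partial=\mathrm{Ind}_P^G(\mathbb{1}_P)$ decomposes as a direct sum of the trivial representation and a unique irreducible constituent $\pi_n$ of dimension $(m_n-1)\prod_{j=1}^{n-1}m_j$ for each $n\ge1$. In particular, the representation is multiplicity-free and the zeta function of $\rho_\partial$ is $$\zeta_{\rho_\partial}(s)=1+\sum_{i=1}^\infty(m_i-1)^{-s}\prod_{j=1}^{i-1}m_j^{-s}$$ with abscissa of convergence $\alpha(\rho_\partial)=0$.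
   Context: Tree. The vertices of level $n\ge0$ of $\mathcal{T}_m$ are the sequences $(w_1,\dots,w_n)$ with $w_i\in\{0,\dots,m_i-1\}$; the root is the empty sequence; a vertex $v$ of level $n$ and a vertex $w$ of level $n+1$ are joined by an edge iff $v$ is a prefix of $w$. The boundary $\partial\mathcal{T}_m$ is the profinite space of infinite sequences $(\xi_i)_{i\in\mathbb{N}}$ with $\xi_i\in\{0,\dots,m_i-1\}$, with metric $d(\xi,\eta)=\frac{1}{1+|\mathrm{pre}(\xi,\eta)|}$ for $\xi\ne\eta$, where $|\mathrm{pre}(\xi,\eta)|$ is the length of the longest common prefix (and $d(\xi,\xi)=0$). $\mathrm{Aut}(\mathcal{T}_m)$ is the profinite group of rooted automorphisms, acting from the right. A group $G$ acting from the right by isometries on a metric space $(X,d)$ acts distance-transitively if for all $x_1,x_2,y_1,y_2\in X$ with $d(x_1,x_2)=d(y_1,y_2)$ there is $g\in G$ with $x_ig=y_i$ for $i\in\{1,2\}$. Representations are over $\mathbb{C}$. $\mathrm{Ind}_P^G(\mathbb{1}_P)$ is the space of locally constant functions $f\colon G\to\mathbb{C}$ with $f(hx)=f(x)$ for $h\in P$, with $G$ acting by right translation (equivalently, locally constant functions on $\partial\mathcal{T}_m$). For a smooth representation $\rho$ with finitely many irreducible constituents (with multiplicity) of each dimension, $\zeta_\rho(s)=\sum_{\pi}m(\pi,\rho)(\dim\pi)^{-s}$, summed over isomorphism classes of smooth irreducible representations $\pi$ of $G$, with $m(\pi,\rho)$ the multiplicity of $\pi$ in $\rho$; $\alpha(\rho)$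 is the abscissa of convergence of this Dirichlet series. *)

theory Defs
  imports
    "HOL-Analysis.Analysis"
    "HOL-Algebra.Bij"
    "HOL-Library.Function_Algebras"
    "HOL-Library.Sublist"
begin

section \<open>Spherically homogeneous rooted trees\<close>

text \<open>
  The branching sequence \<open>m\<close> is indexed from 1; the value \<open>m 0\<close> is never used.  A vertex
  \<open>(w\<^sub>1, \<dots>, w\<^sub>n)\<close> is the list \<open>[w\<^sub>1, \<dots>, w\<^sub>n]\<close>, so \<open>w ! i\<close> is \<open>w\<^sub>i\<^sub>+\<^sub>1\<close>.
\<close>

definition vertices :: "(nat \<Rightarrow> nat) \<Rightarrow> nat list set" where
  "vertices m = {w. \<forall>i < length w. w ! i < m (Suc i)}"

definition joined :: "nat list \<Rightarrow> nat list \<Rightarrow> bool" where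
  "joined v w \<longleftrightarrow>
     (length w = Suc (length v) \<and> prefix v w) \<or> (length v = Suc (length w) \<and> prefix w v)"

definition boundary :: "(nat \<Rightarrow> nat) \<Rightarrow> (nat \<Rightarrow> nat) set" where
  "boundary m = (\<Pi>\<^sub>E i\<in>{1..}. {0..<m i})"

definition pref :: "(nat \<Rightarrow> nat) \<Rightarrow> nat \<Rightarrow> nat list" where
  "pref \<xi> n = map \<xi> [1..<Suc n]"

definition bdist :: "(nat \<Rightarrow> nat) \<Rightarrow> (nat \<Rightarrow> nat) \<Rightarrow> real" where
  "bdist \<xi> \<eta> = (if \<xi> = \<eta> then 0 else 1 / (1 + real (Max {n. pref \<xi> n = pref \<eta> n})))"

text \<open>
  Automorphisms act from the right: in the product \<open>g \<otimes> h\<close> the factor \<open>g\<close> is applied first.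
\<close>

definition AutT :: "(nat \<Rightarrow> nat) \<Rightarrow> (nat list \<Rightarrow> nat list) monoid" where
  "AutT m =
     \<lparr>carrier = {g \<in> extensional (vertices m).
         bij_betw g (vertices m) (vertices m) \<and> g [] = [] \<and>
         (\<forall>v\<in>vertices m. \<forall>w\<in>vertices m. joined (g v) (g w) \<longleftrightarrow> joined v w)},
      mult = (\<lambda>g h. compose (vertices m) h g),
      one = (\<lambda>v\<in>vertices m. v)\<rparr>"

text \<open>
  The profinite topology on the automorphism group is the topology of pointwise convergence on
  the discrete vertex set; the pointwise stabilisers of the finite levels form a basis of
  neighbourhoods of the identity.
\<close>

definition aut_top :: "(nat \<Rightarrow> nat) \<Rightarrow> (nat list \<Rightarrow> nat list) topology" where
  "aut_top m =
     subtopology (product_topology (\<lambda>_. discrete_topology (vertices m)) (vertices m))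
       (carrier (AutT m))"

text \<open>\<open>bact g \<xi>\<close> is \<open>\<xi>g\<close>: its \<open>i\<close>-th entry is the last letter of the image of the
  length-\<open>i\<close> prefix of \<open>\<xi>\<close>.  See \<open>pref_bact\<close> below.\<close>

definition bact :: "(nat list \<Rightarrow> nat list) \<Rightarrow> (nat \<Rightarrow> nat) \<Rightarrow> nat \<Rightarrow> nat" where
  "bact g \<xi> = (\<lambda>i\<in>{1..}. last (g (pref \<xi> i)))"

definition distance_transitive ::
    "'g set \<Rightarrow> 'p set \<Rightarrow> ('p \<Rightarrow> 'p \<Rightarrow> real) \<Rightarrow> ('g \<Rightarrow> 'p \<Rightarrow> 'p) \<Rightarrow> bool" where
  "distance_transitive G X d a \<longleftrightarrow>
     (\<forall>g\<in>G. \<forall>x\<in>X. \<forall>y\<in>X. d (a g x) (a g y) = d x y) \<and>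
     (\<forall>x\<^sub>1\<in>X. \<forall>x\<^sub>2\<in>X. \<forall>y\<^sub>1\<in>X. \<forall>y\<^sub>2\<in>X. d x\<^sub>1 x\<^sub>2 = d y\<^sub>1 y\<^sub>2 \<longrightarrow>
        (\<exists>g\<in>G. a g x\<^sub>1 = y\<^sub>1 \<and> a g x\<^sub>2 = y\<^sub>2))"

definition point_stabiliser ::
    "(nat list \<Rightarrow> nat list) set \<Rightarrow> (nat \<Rightarrow> nat) \<Rightarrow> (nat list \<Rightarrow> nat list) set" where
  "point_stabiliser G \<xi> = {g \<in> G. bact g \<xi> = \<xi>}"


section \<open>Complex representations of topological groups\<close>

text \<open>
  The space of a representation is a complex linear subspace of some function type \<open>'x \<Rightarrow> complex\<close>.
\<close>

definition fscale :: "complex \<Rightarrow> ('x \<Rightarrow> complex) \<Rightarrow> 'x \<Rightarrow> complex" where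
  "fscale c f = (\<lambda>x. c * f x)"

interpretation fs: vector_space fscale
  by unfold_locales (auto simp: fscale_def fun_eq_iff algebra_simps)

record ('g, 'x) rep =
  rspace :: "('x \<Rightarrow> complex) set"
  ract :: "'g \<Rightarrow> ('x \<Rightarrow> complex) \<Rightarrow> 'x \<Rightarrow> complex"

definition linear_between ::
    "('x \<Rightarrow> complex) set \<Rightarrow> ('y \<Rightarrow> complex) set \<Rightarrow> (('x \<Rightarrow> complex) \<Rightarrow> 'y \<Rightarrow> complex) \<Rightarrow> bool" where
  "linear_between V W \<phi> \<longleftrightarrow>
     \<phi> ` V \<subseteq> W \<and>
     (\<forall>u\<in>V. \<forall>v\<in>V. \<phi> (u + v) = \<phi> u + \<phi> v) \<and>
     (\<forall>c. \<forall>v\<in>V. \<phi> (fscale c v) = fscale c (\<phi> v))"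

definition is_rep :: "'g monoid \<Rightarrow> ('g, 'x) rep \<Rightarrow> bool" where
  "is_rep G \<rho> \<longleftrightarrow>
     fs.subspace (rspace \<rho>) \<and>
     (\<forall>g\<in>carrier G. linear_between (rspace \<rho>) (rspace \<rho>) (ract \<rho> g)) \<and>
     (\<forall>v\<in>rspace \<rho>. ract \<rho> \<one>\<^bsub>G\<^esub> v = v) \<and>
     (\<forall>g\<in>carrier G. \<forall>h\<in>carrier G. \<forall>v\<in>rspace \<rho>.
        ract \<rho> (g \<otimes>\<^bsub>G\<^esub> h) v = ract \<rho> g (ract \<rho> h v))"

definition smooth_rep :: "'g monoid \<Rightarrow> 'g topology \<Rightarrow> ('g, 'x) rep \<Rightarrow> bool" where
  "smooth_rep G T \<rho> \<longleftrightarrow>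
     is_rep G \<rho> \<and> (\<forall>v\<in>rspace \<rho>. openin T {g \<in> carrier G. ract \<rho> g v = v})"

definition invariant :: "'g monoid \<Rightarrow> ('g, 'x) rep \<Rightarrow> ('x \<Rightarrow> complex) set \<Rightarrow> bool" where
  "invariant G \<rho> W \<longleftrightarrow>
     fs.subspace W \<and> W \<subseteq> rspace \<rho> \<and> (\<forall>g\<in>carrier G. ract \<rho> g ` W \<subseteq> W)"

definition irreducible_rep :: "'g monoid \<Rightarrow> ('g, 'x) rep \<Rightarrow> bool" where
  "irreducible_rep G \<rho> \<longleftrightarrow>
     is_rep G \<rho> \<and> rspace \<rho> \<noteq> {0} \<and> (\<forall>W. invariant G \<rho> W \<longrightarrow> W = {0} \<or> W = rspace \<rho>)"

definition trivial_rep :: "'g monoid \<Rightarrow> ('g, 'x) rep \<Rightarrow> bool" where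
  "trivial_rep G \<rho> \<longleftrightarrow>
     is_rep G \<rho> \<and> fs.dim (rspace \<rho>) = 1 \<and> (\<forall>g\<in>carrier G. \<forall>v\<in>rspace \<rho>. ract \<rho> g v = v)"

abbreviation restrict_rep :: "('g, 'x) rep \<Rightarrow> ('x \<Rightarrow> complex) set \<Rightarrow> ('g, 'x) rep" where
  "restrict_rep \<rho> W \<equiv> \<rho>\<lparr>rspace := W\<rparr>"

definition iso_rep :: "'g monoid \<Rightarrow> ('g, 'x) rep \<Rightarrow> ('g, 'y) rep \<Rightarrow> bool" where
  "iso_rep G \<rho> \<sigma> \<longleftrightarrow>
     (\<exists>\<phi>. linear_between (rspace \<rho>) (rspace \<sigma>) \<phi> \<and> bij_betw \<phi> (rspace \<rho>) (rspace \<sigma>) \<and>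
        (\<forall>g\<in>carrier G. \<forall>v\<in>rspace \<rho>. \<phi> (ract \<rho> g v) = ract \<sigma> g (\<phi> v)))"

definition direct_sum :: "'i set \<Rightarrow> ('i \<Rightarrow> ('x \<Rightarrow> complex) set) \<Rightarrow> ('x \<Rightarrow> complex) set \<Rightarrow> bool" where
  "direct_sum I U V \<longleftrightarrow>
     V = {\<Sum>i\<in>F. u i | F u. finite F \<and> F \<subseteq> I \<and> (\<forall>i\<in>F. u i \<in> U i)} \<and>
     (\<forall>F u. finite F \<and> F \<subseteq> I \<and> (\<forall>i\<in>F. u i \<in> U i) \<and> (\<Sum>i\<in>F. u i) = 0 \<longrightarrow> (\<forall>i\<in>F. u i = 0))"

definition irreducible_subrep :: "'g monoid \<Rightarrow> ('g, 'x) rep \<Rightarrow> ('x \<Rightarrow> complex) set \<Rightarrow> bool" where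
  "irreducible_subrep G \<rho> W \<longleftrightarrow> invariant G \<rho> W \<and> irreducible_rep G (restrict_rep \<rho> W)"

definition irreducible_decomposition ::
    "'g monoid \<Rightarrow> ('g, 'x) rep \<Rightarrow> ('x \<Rightarrow> complex) set set \<Rightarrow> bool" where
  "irreducible_decomposition G \<rho> D \<longleftrightarrow>
     (\<forall>W\<in>D. irreducible_subrep G \<rho> W) \<and> direct_sum D (\<lambda>W. W) (rspace \<rho>)"

text \<open>
  The multiplicity of \<open>\<pi>\<close> in \<open>\<rho>\<close> is the number of summands isomorphic to \<open>\<pi>\<close> in a
  decomposition of \<open>\<rho>\<close> into irreducible subrepresentations; it does not depend on the
  decomposition.  It is meaningful only for semisimple \<open>\<rho>\<close> with finite multiplicities, such as
  those satisfying \<open>strongly_admissible\<close>.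
\<close>

definition multiplicity_rep :: "'g monoid \<Rightarrow> ('g, 'y) rep \<Rightarrow> ('g, 'x) rep \<Rightarrow> nat" where
  "multiplicity_rep G \<pi> \<rho> =
     (THE k. \<forall>D. irreducible_decomposition G \<rho> D \<longrightarrow>
        finite {W\<in>D. iso_rep G \<pi> (restrict_rep \<rho> W)} \<and>
        card {W\<in>D. iso_rep G \<pi> (restrict_rep \<rho> W)} = k)"

definition strongly_admissible :: "'g monoid \<Rightarrow> 'g topology \<Rightarrow> ('g, 'x) rep \<Rightarrow> bool" where
  "strongly_admissible G T \<rho> \<longleftrightarrow>
     smooth_rep G T \<rho> \<and>
     (\<exists>D. irreducible_decomposition G \<rho> D \<and> (\<forall>d. finite {W\<in>D. fs.dim W = d}))"

text \<open>
  To speak of the set of all smooth irreducible representations up to isomorphism, we fix the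
  ambient vector space of all functions from the type of group elements to the complex numbers.
  For a compact group this is no restriction: if \<open>\<pi>\<close> is smooth and irreducible and \<open>l\<close> is a
  nonzero functional on \<open>\<pi>\<close>, then sending \<open>v\<close> to the matrix coefficient \<open>g \<mapsto> l (\<pi>(g) v)\<close>
  embeds \<open>\<pi>\<close> into the functions on the group.
\<close>

definition smooth_irreps :: "'g monoid \<Rightarrow> 'g topology \<Rightarrow> ('g, 'g) rep set" where
  "smooth_irreps G T = {\<pi>. smooth_rep G T \<pi> \<and> irreducible_rep G \<pi>}"

definition irrep_classes :: "'g monoid \<Rightarrow> 'g topology \<Rightarrow> ('g, 'g) rep set set" where
  "irrep_classes G T =
     smooth_irreps G T //
       {(\<pi>, \<pi>'). \<pi> \<in> smooth_irreps G T \<and> \<pi>' \<in> smooth_irreps G T \<and> iso_rep G \<pi> \<pi>'}"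

definition multiplicity_free :: "'g monoid \<Rightarrow> 'g topology \<Rightarrow> ('g, 'x) rep \<Rightarrow> bool" where
  "multiplicity_free G T \<rho> \<longleftrightarrow> (\<forall>\<pi>\<in>smooth_irreps G T. multiplicity_rep G \<pi> \<rho> \<le> 1)"

definition zeta_term :: "'g monoid \<Rightarrow> ('g, 'x) rep \<Rightarrow> complex \<Rightarrow> ('g, 'g) rep set \<Rightarrow> complex" where
  "zeta_term G \<rho> s C =
     (let \<pi> = (SOME \<pi>. \<pi> \<in> C)
      in of_nat (multiplicity_rep G \<pi> \<rho>) * of_nat (fs.dim (rspace \<pi>)) powr (- s))"

definition zeta_converges ::
    "'g monoid \<Rightarrow> 'g topology \<Rightarrow> ('g, 'x) rep \<Rightarrow> complex \<Rightarrow> bool" where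
  "zeta_converges G T \<rho> s \<longleftrightarrow> zeta_term G \<rho> s summable_on irrep_classes G T"

definition zeta_rep :: "'g monoid \<Rightarrow> 'g topology \<Rightarrow> ('g, 'x) rep \<Rightarrow> complex \<Rightarrow> complex" where
  "zeta_rep G T \<rho> s = (\<Sum>\<^sub>\<infinity>C\<in>irrep_classes G T. zeta_term G \<rho> s C)"

text \<open>
  The Dirichlet series has nonnegative coefficients, so convergence, absolute convergence and
  unordered summability on a half-plane coincide.
\<close>

definition abscissa_of_convergence ::
    "'g monoid \<Rightarrow> 'g topology \<Rightarrow> ('g, 'x) rep \<Rightarrow> ereal" where
  "abscissa_of_convergence G T \<rho> =
     Inf (ereal ` {\<sigma>::real. \<forall>s. Re s > \<sigma> \<longrightarrow> zeta_converges G T \<rho> s})"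


section \<open>Induction of the trivial representation\<close>

text \<open>
  Functions on the group are extended by 0 (not by \<open>undefined\<close>) outside its carrier, so that they
  form a linear subspace.
\<close>

definition induced_trivial :: "'g monoid \<Rightarrow> 'g topology \<Rightarrow> 'g set \<Rightarrow> ('g, 'g) rep" where
  "induced_trivial G T P =
     \<lparr>rspace = {f. (\<forall>x. x \<notin> carrier G \<longrightarrow> f x = 0) \<and>
          (\<forall>x\<in>carrier G. \<exists>N. openin T N \<and> x \<in> N \<and> (\<forall>y\<in>N. f y = f x)) \<and>
          (\<forall>h\<in>P. \<forall>x\<in>carrier G. f (h \<otimes>\<^bsub>G\<^esub> x) = f x)},
      ract = (\<lambda>g f x. if x \<in> carrier G then f (x \<otimes>\<^bsub>G\<^esub> g) else 0)\<rparr>"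


section \<open>The action on the boundary\<close>

lemma length_pref [simp]: "length (pref \<xi> n) = n"
  by (simp add: pref_def)

lemma pref_in_vertices: "\<xi> \<in> boundary m \<Longrightarrow> pref \<xi> n \<in> vertices m"
  by (auto simp: vertices_def pref_def boundary_def PiE_def Pi_def simp del: upt_Suc)

lemma pref_Suc: "pref \<xi> (Suc n) = pref \<xi> n @ [\<xi> (Suc n)]"
  by (simp add: pref_def)

lemma take_in_vertices: "w \<in> vertices m \<Longrightarrow> take n w \<in> vertices m"
  by (auto simp: vertices_def)

lemma butlast_in_vertices: "w \<in> vertices m \<Longrightarrow> butlast w \<in> vertices m"
  by (simp add: butlast_conv_take take_in_vertices)

lemma joined_butlast: "w \<noteq> [] \<Longrightarrow> joined (butlast w) w"
  unfolding joined_def by (auto simp: prefixeq_butlast)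

lemma joinedD: "joined v w \<Longrightarrow> (w \<noteq> [] \<and> v = butlast w) \<or> (v \<noteq> [] \<and> w = butlast v)"
proof -
  have *: "w \<noteq> [] \<and> v = butlast w" if l: "length w = Suc (length v)" and "prefix v w" for v w :: "nat list"
  proof -
    obtain u where u: "w = v @ u" using \<open>prefix v w\<close> by (auto simp: prefix_def)
    with l have "length u = 1" by simp
    then obtain a where "u = [a]" by (cases u) auto
    with u show ?thesis by simp
  qed
  assume "joined v w"
  then show ?thesis unfolding joined_def using *[of w v] *[of v w] by blast
qed

lemma AutT_level:
  assumes g: "g \<in> carrier (AutT m)"
  shows "w \<in> vertices m \<Longrightarrow> length (g w) = length w \<and> (w \<noteq> [] \<longrightarrow> g (butlast w) = butlast (g w))"
proof (induction "length w" arbitrary: w rule: less_induct)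
  case less
  have bij: "bij_betw g (vertices m) (vertices m)" and g0: "g [] = []"
    and adj: "\<And>v w. v \<in> vertices m \<Longrightarrow> w \<in> vertices m \<Longrightarrow> joined (g v) (g w) \<longleftrightarrow> joined v w"
    using g by (auto simp: AutT_def)
  show ?case
  proof (cases "w = []")
    case True
    then show ?thesis using g0 by simp
  next
    case False
    let ?v = "butlast w"
    have v: "?v \<in> vertices m" using less.prems by (rule butlast_in_vertices)
    have lv: "length ?v < length w" using False by simp
    have IH: "length (g ?v) = length ?v" "?v \<noteq> [] \<Longrightarrow> g (butlast ?v) = butlast (g ?v)"
      using less.hyps[OF lv v] by auto
    have "joined (g ?v) (g w)" using adj[OF v less.prems] joined_butlast[OF False] by simp
    from joinedD[OF this] have "g w \<noteq> [] \<and> g ?v = butlast (g w)"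
    proof
      assume a: "g ?v \<noteq> [] \<and> g w = butlast (g ?v)"
      then have "?v \<noteq> []" using g0 by auto
      then have "g w = g (butlast ?v)" using a IH(2) by simp
      then have "w = butlast ?v"
        using bij less.prems butlast_in_vertices[OF v] by (meson bij_betw_imp_inj_on inj_onD)
      then have "length w = length (butlast ?v)" by simp
      with False \<open>?v \<noteq> []\<close> show ?thesis by (cases "length w") auto
    qed
    then have gw: "g w \<noteq> []" "g ?v = butlast (g w)" by auto
    have "length (g w) - 1 = length w - 1" using IH(1) gw(2) by simp
    moreover have "length (g w) > 0" "length w > 0" using gw(1) False by auto
    ultimately have "length (g w) = length w" by arith
    with gw show ?thesis by simp
  qed
qed

lemma AutT_in_vertices: "g \<in> carrier (AutT m) \<Longrightarrow> w \<in> vertices m \<Longrightarrow> g w \<in> vertices m"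
  by (auto simp: AutT_def bij_betw_def)

lemma pref_bact:
  assumes g: "g \<in> carrier (AutT m)" and \<xi>: "\<xi> \<in> boundary m"
  shows "pref (bact g \<xi>) n = g (pref \<xi> n)"
proof (induction n)
  case 0
  then show ?case using g by (simp add: pref_def AutT_def)
next
  case (Suc n)
  have w: "pref \<xi> (Suc n) \<in> vertices m" using \<xi> by (rule pref_in_vertices)
  have "pref \<xi> (Suc n) \<noteq> []" by (simp add: pref_Suc)
  then have l: "length (g (pref \<xi> (Suc n))) = Suc n"
    and b: "g (pref \<xi> n) = butlast (g (pref \<xi> (Suc n)))"
    using AutT_level[OF g w] by (auto simp: pref_Suc)
  have "g (pref \<xi> (Suc n)) \<noteq> []" using l by auto
  then have "g (pref \<xi> (Suc n)) = butlast (g (pref \<xi> (Suc n))) @ [last (g (pref \<xi> (Suc n)))]"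
    by simp
  also have "\<dots> = pref (bact g \<xi>) (Suc n)"
  proof -
    have "bact g \<xi> (Suc n) = last (g (pref \<xi> (Suc n)))" by (simp add: bact_def)
    with Suc b show ?thesis by (simp only: pref_Suc[of "bact g \<xi>"])
  qed
  finally show ?case by simp
qed

lemma bact_in_boundary:
  assumes g: "g \<in> carrier (AutT m)" and \<xi>: "\<xi> \<in> boundary m"
  shows "bact g \<xi> \<in> boundary m"
proof -
  have "bact g \<xi> i < m i" if i1: "1 \<le> i" for i
  proof -
    obtain n where i: "i = Suc n" using i1 Suc_le_D[of 0 i] by auto
    have "pref (bact g \<xi>) (Suc n) \<in> vertices m"
      using pref_bact[OF g \<xi>] AutT_in_vertices[OF g pref_in_vertices[OF \<xi>]] by simp
    then have "pref (bact g \<xi>) (Suc n) ! n < m (Suc n)"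
      unfolding vertices_def by simp
    then show ?thesis using i by (simp add: pref_Suc nth_append)
  qed
  then show ?thesis by (auto simp: boundary_def bact_def)
qed

lemma boundary_eqI:
  assumes "\<xi> \<in> boundary m" "\<eta> \<in> boundary m" "\<And>n. pref \<xi> n = pref \<eta> n"
  shows "\<xi> = \<eta>"
proof (rule PiE_ext[where k = "{1..}" and s = "\<lambda>i. {0..<m i}"])
  fix i :: nat assume "i \<in> {1..}"
  then obtain n where "i = Suc n" using Suc_le_D[of 0 i] by auto
  then show "\<xi> i = \<eta> i" using assms(3)[of i] by (simp add: pref_Suc)
qed (use assms(1,2) in \<open>simp_all add: boundary_def\<close>)

text \<open>Hence the isometry clause of \<open>distance_transitive\<close> holds automatically on the boundary.\<close>

lemma bdist_bact:
  assumes g: "g \<in> carrier (AutT m)" and \<xi>: "\<xi> \<in> boundary m" and \<eta>: "\<eta> \<in> boundary m"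
  shows "bdist (bact g \<xi>) (bact g \<eta>) = bdist \<xi> \<eta>"
proof -
  have inj: "inj_on g (vertices m)" using g by (simp add: AutT_def bij_betw_def)
  have iff: "pref (bact g \<xi>) n = pref (bact g \<eta>) n \<longleftrightarrow> pref \<xi> n = pref \<eta> n" for n
    using inj_on_eq_iff[OF inj pref_in_vertices[OF \<xi>] pref_in_vertices[OF \<eta>]]
    by (simp add: pref_bact[OF g \<xi>] pref_bact[OF g \<eta>])
  have "bact g \<xi> = bact g \<eta> \<longleftrightarrow> \<xi> = \<eta>"
  proof
    assume "bact g \<xi> = bact g \<eta>"
    then have "pref \<xi> n = pref \<eta> n" for n by (simp only: iff[symmetric])
    then show "\<xi> = \<eta>" by (rule boundary_eqI[OF \<xi> \<eta>])
  qed simp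
  then show ?thesis by (simp only: bdist_def iff)
qed

lemma group_AutT: "group (AutT m)"
proof (rule groupI)
  let ?V = "vertices m"
  fix g h k
  have eqI: "f = f'" if "f \<in> extensional ?V" "f' \<in> extensional ?V" "\<And>v. v \<in> ?V \<Longrightarrow> f v = f' v" for f f' :: "nat list \<Rightarrow> nat list"
    using that by (rule extensionalityI)
  have nil: "[] \<in> ?V" by (simp add: vertices_def)
  show "\<one>\<^bsub>AutT m\<^esub> \<in> carrier (AutT m)"
    using nil by (auto simp: AutT_def bij_betw_def inj_on_def)
  assume g: "g \<in> carrier (AutT m)"
  have gV: "\<And>v. v \<in> ?V \<Longrightarrow> g v \<in> ?V" using g by (rule AutT_in_vertices)
  show "\<one>\<^bsub>AutT m\<^esub> \<otimes>\<^bsub>AutT m\<^esub> g = g"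
    using g by (intro eqI) (auto simp: AutT_def compose_def)
  show "\<exists>f\<in>carrier (AutT m). f \<otimes>\<^bsub>AutT m\<^esub> g = \<one>\<^bsub>AutT m\<^esub>"
  proof
    let ?f = "\<lambda>v\<in>?V. inv_into ?V g v"
    have bij: "bij_betw g ?V ?V" and g0: "g [] = []" using g by (auto simp: AutT_def)
    have adj: "joined (g v) (g w) \<longleftrightarrow> joined v w" if "v \<in> ?V" "w \<in> ?V" for v w
      using g that by (simp add: AutT_def)
    have fV: "?f v \<in> ?V" "g (?f v) = v" if "v \<in> ?V" for v
      using that bij by (auto simp: bij_betw_def inv_into_into f_inv_into_f)
    have b: "bij_betw ?f ?V ?V" using bij by (rule bij_betw_restrict_eq[THEN iffD2, OF bij_betw_inv_into])
    have f0: "?f [] = []" using bij g0 nil by (simp add: bij_betw_def inv_into_f_eq)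
    have j: "joined (?f v) (?f w) \<longleftrightarrow> joined v w" if "v \<in> ?V" "w \<in> ?V" for v w
    proof -
      have "joined (g (?f v)) (g (?f w)) \<longleftrightarrow> joined (?f v) (?f w)"
        using adj[OF fV(1)[OF that(1)] fV(1)[OF that(2)]] .
      then show ?thesis using fV(2) that by simp
    qed
    show "?f \<in> carrier (AutT m)" unfolding AutT_def using b f0 j by auto
    show "?f \<otimes>\<^bsub>AutT m\<^esub> g = \<one>\<^bsub>AutT m\<^esub>"
      using fV by (intro eqI) (auto simp: AutT_def compose_def)
  qed
  assume h: "h \<in> carrier (AutT m)"
  have hV: "\<And>v. v \<in> ?V \<Longrightarrow> h v \<in> ?V" using h by (rule AutT_in_vertices)
  have "bij_betw (compose ?V h g) ?V ?V"
    using g h by (auto simp: AutT_def intro: bij_betw_compose)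
  then show "g \<otimes>\<^bsub>AutT m\<^esub> h \<in> carrier (AutT m)"
    using g h gV nil by (auto simp: AutT_def compose_def)
  assume k: "k \<in> carrier (AutT m)"
  show "g \<otimes>\<^bsub>AutT m\<^esub> h \<otimes>\<^bsub>AutT m\<^esub> k = g \<otimes>\<^bsub>AutT m\<^esub> (h \<otimes>\<^bsub>AutT m\<^esub> k)"
    using gV by (auto simp: AutT_def compose_def fun_eq_iff)
qed

end

theory Submission
  imports Defs
begin

text \<open>
  By compactness every function in the induced representation factors through the image of \<open>\<xi>\<close> in
  some level of the tree, so the representation is the increasing union of the spaces \<open>U n\<close> of
  functions on level \<open>n\<close>.  Let \<open>V n\<close> be the space of functions on level \<open>n\<close> that sum to 0 over
  the children of each vertex of level \<open>n - 1\<close>; then \<open>U n\<close> is the direct sum of \<open>U (n - 1)\<close> and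
  \<open>V n\<close>.  Distance-transitivity makes the stabiliser of a vertex \<open>v\<close> transitive on siblings other
  than \<open>v\<close>, so the functions in \<open>V n\<close> fixed by the stabiliser of \<open>v\<close> form a line, and the
  translates of this line span \<open>V n\<close>.  Averaging over the stabiliser of \<open>v\<close> a function that does not
  vanish at \<open>v\<close> shows that every nonzero invariant subspace of \<open>V n\<close> contains such a line, whence
  \<open>V n\<close> is irreducible.  Likewise, if \<open>n\<close> is minimal with \<open>W \<subseteq> U n\<close> for an irreducible \<open>W\<close>,
  averaging over the stabilisers of vertices of level \<open>n - 1\<close> lands in \<open>W \<inter> U (n - 1) = 0\<close>, which
  forces \<open>W = V n\<close>.
\<close>

subsection \<open>The automorphism group is compact\<close>

abbreviation level :: "(nat \<Rightarrow> nat) \<Rightarrow> nat \<Rightarrow> nat list set" where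
  "level m n \<equiv> {w \<in> vertices m. length w = n}"

lemma append_in_vertices_iff: "p @ [i] \<in> vertices m \<longleftrightarrow> p \<in> vertices m \<and> i < m (Suc (length p))"
proof
  assume "p @ [i] \<in> vertices m"
  then have *: "(p @ [i]) ! j < m (Suc j)" if "j < Suc (length p)" for j
    using that unfolding vertices_def by simp
  have "p ! j < m (Suc j)" if "j < length p" for j
    using *[of j] that by (simp add: nth_append)
  then show "p \<in> vertices m \<and> i < m (Suc (length p))"
    using *[of "length p"] unfolding vertices_def by simp
next
  assume p: "p \<in> vertices m \<and> i < m (Suc (length p))"
  have "(p @ [i]) ! j < m (Suc j)" if "j < Suc (length p)" for j
    using p that unfolding vertices_def by (cases "j = length p") (simp_all add: nth_append)
  then show "p @ [i] \<in> vertices m" unfolding vertices_def by simp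
qed

lemma level_Suc_eq: "level m (Suc n) = (\<lambda>(p, i). p @ [i]) ` (level m n \<times> {..<m (Suc n)})"
proof (intro equalityI subsetI)
  fix w assume w: "w \<in> level m (Suc n)"
  then obtain p i where pi: "w = p @ [i]" by (cases w rule: rev_cases) auto
  then have "(p, i) \<in> level m n \<times> {..<m (Suc n)}" using w by (auto simp: append_in_vertices_iff)
  then show "w \<in> (\<lambda>(p, i). p @ [i]) ` (level m n \<times> {..<m (Suc n)})" unfolding pi by force
qed (auto simp: append_in_vertices_iff)

lemma finite_level: "finite (level m n)"
proof (induction n)
  case 0
  have "level m 0 \<subseteq> {[]}" by auto
  then show ?case by (rule finite_subset) simp
qed (simp add: level_Suc_eq)

lemma continuous_map_eval:
  assumes "v \<in> vertices m"
  shows "continuous_map (aut_top m) (discrete_topology (vertices m)) (\<lambda>g. g v)"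
  unfolding aut_top_def
  by (rule continuous_map_from_subtopology, rule continuous_map_product_projection) (rule assms)

text \<open>A condition on two coordinates is the preimage of a subset of a discrete space, and
  every such subset is closed.\<close>

lemma closedin_product_eval:
  assumes "v \<in> vertices m" "w \<in> vertices m"
  shows "closedin (product_topology (\<lambda>_. discrete_topology (vertices m)) (vertices m))
    {g \<in> vertices m \<rightarrow>\<^sub>E vertices m. Q (g v) (g w)}"
proof -
  let ?X = "product_topology (\<lambda>_. discrete_topology (vertices m)) (vertices m)"
  have "continuous_map ?X (discrete_topology (vertices m \<times> vertices m)) (\<lambda>g. (g v, g w))"
    using continuous_map_product_projection[OF assms(1), of "\<lambda>_. discrete_topology (vertices m)"]
      continuous_map_product_projection[OF assms(2), of "\<lambda>_. discrete_topology (vertices m)"]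
    unfolding prod_topology_discrete_topology by (intro continuous_map_paired[THEN iffD2] conjI)
  then have "closedin ?X {g \<in> topspace ?X. (g v, g w) \<in> {(a, b) \<in> vertices m \<times> vertices m. Q a b}}"
    by (rule closedin_continuous_map_preimage) auto
  also have "{g \<in> topspace ?X. (g v, g w) \<in> {(a, b) \<in> vertices m \<times> vertices m. Q a b}} =
    {g \<in> vertices m \<rightarrow>\<^sub>E vertices m. Q (g v) (g w)}"
    using assms by auto
  finally show ?thesis .
qed

text \<open>Exhibits the automorphisms as a closed part of a compact set: a product of finite
  levels, cut out by conditions on two values at a time. Surjectivity follows because an injective
  self-map of a finite level is onto, and the root is fixed because lengths are preserved.\<close>

lemma carrier_AutT_eq:
  "carrier (AutT m) =
     (\<Pi>\<^sub>E v\<in>vertices m. level m (length v)) \<inter>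
     (\<Inter>v\<in>vertices m. \<Inter>w\<in>vertices m. {g \<in> vertices m \<rightarrow>\<^sub>E vertices m.
        (g v = g w \<longrightarrow> v = w) \<and> (joined (g v) (g w) \<longleftrightarrow> joined v w)})"
  (is "_ = ?B \<inter> ?C")
proof (intro equalityI subsetI)
  fix g assume g: "g \<in> carrier (AutT m)"
  have "inj_on g (vertices m)" using g by (simp add: AutT_def bij_betw_def)
  moreover have "g \<in> ?B"
    using g AutT_level[OF g] AutT_in_vertices[OF g] by (auto simp: PiE_iff AutT_def)
  ultimately show "g \<in> ?B \<inter> ?C"
    using g AutT_in_vertices[OF g] by (auto simp: PiE_iff AutT_def inj_on_def)
next
  fix g assume g: "g \<in> ?B \<inter> ?C"
  have inj: "inj_on g (vertices m)" using g by (auto simp: inj_on_def)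
  have lev: "g ` level m n = level m n" for n
    by (rule endo_inj_surj[OF finite_level])
       (use g in \<open>auto simp: PiE_iff intro: inj_on_subset[OF inj]\<close>)
  have "w \<in> g ` vertices m" if "w \<in> vertices m" for w
    using lev[of "length w"] that by (metis (mono_tags, lifting) image_iff mem_Collect_eq)
  then have "g ` vertices m = vertices m" using g by (auto simp: PiE_iff)
  moreover have "[] \<in> vertices m" by (simp add: vertices_def)
  then have "g [] = []" using g by (fastforce simp: PiE_iff)
  moreover have "\<forall>v\<in>vertices m. \<forall>w\<in>vertices m. joined (g v) (g w) \<longleftrightarrow> joined v w"
    using g by blast
  moreover have "g \<in> extensional (vertices m)" using g by (simp add: PiE_iff)
  ultimately show "g \<in> carrier (AutT m)"
    using inj unfolding AutT_def bij_betw_def by simp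
qed

lemma compact_space_aut_top: "compact_space (aut_top m)"
proof -
  let ?X = "product_topology (\<lambda>_. discrete_topology (vertices m)) (vertices m)"
  let ?C = "\<Inter>v\<in>vertices m. \<Inter>w\<in>vertices m. {g \<in> vertices m \<rightarrow>\<^sub>E vertices m.
        (g v = g w \<longrightarrow> v = w) \<and> (joined (g v) (g w) \<longleftrightarrow> joined v w)}"
  \<comment> \<open>\<open>closedin_INT\<close> asks for a nonempty index set; the root provides
    it.\<close>
  have ne: "vertices m \<noteq> {}" by (auto simp: vertices_def intro: exI[of _ "[]"])
  have C: "closedin ?X ?C" using ne
    by (intro closedin_INT closedin_product_eval)
  have "compactin ?X (\<Pi>\<^sub>E v\<in>vertices m. level m (length v))"
    unfolding compactin_PiE by (auto simp: finite_level compactin_discrete_topology)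
  from compact_Int_closedin[OF this C] have "compactin ?X (carrier (AutT m))"
    unfolding carrier_AutT_eq .
  then show ?thesis unfolding aut_top_def by (rule compact_space_subtopology)
qed

subsection \<open>The action on the levels of the tree\<close>

lemma take_pref: "k \<le> n \<Longrightarrow> take k (pref x n) = pref x k"
  by (auto simp: pref_def take_map simp del: upt_Suc)

lemma butlast_pref_Suc: "butlast (pref x (Suc n)) = pref x n"
  by (simp add: pref_Suc)

text \<open>Lets distance-transitivity be applied by comparing prefixes length by length, without
  evaluating the maximum in \<open>bdist\<close>.\<close>

lemma bdist_cong:
  assumes "x \<in> boundary m" "y \<in> boundary m" "x' \<in> boundary m" "y' \<in> boundary m"
    and "\<And>n. pref x n = pref y n \<longleftrightarrow> pref x' n = pref y' n"
  shows "bdist x y = bdist x' y'"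
proof -
  have "x = y \<longleftrightarrow> x' = y'"
    using boundary_eqI[OF assms(1,2)] boundary_eqI[OF assms(3,4)] assms(5) by metis
  then show ?thesis by (simp only: bdist_def assms(5))
qed

locale boundary_transitive =
  fixes m :: "nat \<Rightarrow> nat" and H :: "(nat list \<Rightarrow> nat list) set" and \<xi> :: "nat \<Rightarrow> nat"
  assumes branching: "n \<ge> 1 \<Longrightarrow> m n \<ge> 2"
    and subgroup: "subgroup H (AutT m)"
    and closed: "closedin (aut_top m) H"
    and transitive: "distance_transitive H (boundary m) bdist bact"
    and base: "\<xi> \<in> boundary m"
begin

abbreviation "G \<equiv> (AutT m)\<lparr>carrier := H\<rparr>"
abbreviation "T \<equiv> subtopology (aut_top m) H"
abbreviation "\<rho> \<equiv> induced_trivial G T (point_stabiliser H \<xi>)"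
abbreviation "X \<equiv> rspace \<rho>"

lemma H_carrier: "g \<in> H \<Longrightarrow> g \<in> carrier (AutT m)"
  using subgroup.subset[OF subgroup] by blast

lemma H_vertices: "g \<in> H \<Longrightarrow> v \<in> vertices m \<Longrightarrow> g v \<in> vertices m"
  using H_carrier AutT_in_vertices by blast

lemma H_length: "g \<in> H \<Longrightarrow> v \<in> vertices m \<Longrightarrow> length (g v) = length v"
  using H_carrier AutT_level by blast

lemma H_butlast: "g \<in> H \<Longrightarrow> v \<in> vertices m \<Longrightarrow> butlast (g v) = g (butlast v)"
proof (cases "v = []")
  case True
  then show "g \<in> H \<Longrightarrow> v \<in> vertices m \<Longrightarrow> butlast (g v) = g (butlast v)"
    using H_length by fastforce
next
  case False
  then show "g \<in> H \<Longrightarrow> v \<in> vertices m \<Longrightarrow> butlast (g v) = g (butlast v)"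
    using AutT_level[OF H_carrier] by metis
qed

lemma H_inj: "g \<in> H \<Longrightarrow> inj_on g (vertices m)"
  using H_carrier by (auto simp: AutT_def bij_betw_def)

lemma mult_eval: "v \<in> vertices m \<Longrightarrow> (x \<otimes>\<^bsub>G\<^esub> g) v = g (x v)"
  by (simp add: AutT_def compose_def)

lemma mult_H: "x \<in> H \<Longrightarrow> g \<in> H \<Longrightarrow> x \<otimes>\<^bsub>G\<^esub> g \<in> H"
  using subgroup.m_closed[OF subgroup] by simp

lemma group_G: "group G"
  using subgroup group_AutT by (metis subgroup.subgroup_is_group)

lemma one_H: "\<one>\<^bsub>G\<^esub> \<in> H"
  using subgroup.one_closed[OF subgroup] by simp

lemma one_eval: "v \<in> vertices m \<Longrightarrow> \<one>\<^bsub>G\<^esub> v = v"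
  by (simp add: AutT_def)

lemma H_inverse:
  assumes "g \<in> H"
  obtains h where "h \<in> H" "g \<otimes>\<^bsub>G\<^esub> h = \<one>\<^bsub>G\<^esub>" "h \<otimes>\<^bsub>G\<^esub> g = \<one>\<^bsub>G\<^esub>"
    "\<And>v. v \<in> vertices m \<Longrightarrow> h (g v) = v" "\<And>v. v \<in> vertices m \<Longrightarrow> g (h v) = v"
proof -
  interpret group G by (rule group_G)
  have h: "inv\<^bsub>G\<^esub> g \<in> H" "g \<otimes>\<^bsub>G\<^esub> inv\<^bsub>G\<^esub> g = \<one>\<^bsub>G\<^esub>" "inv\<^bsub>G\<^esub> g \<otimes>\<^bsub>G\<^esub> g = \<one>\<^bsub>G\<^esub>"
    using assms inv_closed[of g] r_inv[of g] l_inv[of g] by simp_all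
  then show thesis
    using that[of "inv\<^bsub>G\<^esub> g"] mult_eval one_eval by metis
qed

lemma boundary_extension:
  assumes "v \<in> vertices m"
  obtains y where "y \<in> boundary m" "pref y (length v) = v"
proof
  \<comment> \<open>Boundary sequences are indexed from 1 and lists from 0, whence
    \<open>i - 1\<close>. The filler 0 is a legal letter because \<open>m i\<close> is
    positive.\<close>
  let ?y = "\<lambda>i\<in>{1..}. if i \<le> length v then v ! (i - 1) else 0"
  have "?y i < m i" if "i \<ge> 1" for i
  proof (cases "i \<le> length v")
    case True
    have "i - 1 < length v" using that True by simp
    then have "v ! (i - 1) < m (Suc (i - 1))" using assms unfolding vertices_def by blast
    then show ?thesis using that True by simp
  next
    case False
    then show ?thesis using branching[OF that] that by simp
  qed
  then show "?y \<in> boundary m" by (auto simp: boundary_def)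
  show "pref ?y (length v) = v"
    by (rule nth_equalityI) (auto simp: pref_def simp del: upt_Suc)
qed

text \<open>The form in which distance-transitivity is used. Taking \<open>y = x\<close> and
  \<open>y' = x'\<close> gives plain transitivity on the boundary.\<close>

lemma H_transitive_pairs:
  assumes "x \<in> boundary m" "y \<in> boundary m" "x' \<in> boundary m" "y' \<in> boundary m"
    and "\<And>n. pref x n = pref y n \<longleftrightarrow> pref x' n = pref y' n"
  shows "\<exists>g\<in>H. \<forall>n. g (pref x n) = pref x' n \<and> g (pref y n) = pref y' n"
proof -
  have "bdist x y = bdist x' y'" using assms by (rule bdist_cong)
  then obtain g where "g \<in> H" "bact g x = x'" "bact g y = y'"
    using transitive assms(1-4) unfolding distance_transitive_def by meson
  then show ?thesis
    using pref_bact[OF H_carrier] assms(1,2) by metis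
qed

lemma transitive_level:
  assumes "v \<in> vertices m" "w \<in> vertices m" "length v = length w"
  obtains g where "g \<in> H" "g v = w"
proof -
  obtain x where x: "x \<in> boundary m" "pref x (length v) = v"
    using boundary_extension[OF assms(1)] .
  obtain y where y: "y \<in> boundary m" "pref y (length w) = w"
    using boundary_extension[OF assms(2)] .
  obtain g where "g \<in> H" "\<And>n. g (pref x n) = pref y n"
    using H_transitive_pairs[OF x(1) x(1) y(1) y(1)] by auto
  then show thesis using that x y assms(3) by metis
qed

text \<open>Extend \<open>v\<close>, \<open>w\<close>, \<open>w'\<close> to boundary points
  \<open>x\<close>, \<open>y\<close>, \<open>y'\<close>. If \<open>v\<close> is a prefix of
  \<open>w\<close>, it lies at or above the common parent, and any element taking \<open>y\<close>
  to \<open>y'\<close> fixes it. Otherwise \<open>x\<close> parts from \<open>y\<close> and from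
  \<open>y'\<close> at the same depth, so the pairs \<open>x\<close>, \<open>y\<close> and
  \<open>x\<close>, \<open>y'\<close> are equidistant.\<close>

lemma stabiliser_transitive_siblings:
  assumes v: "v \<in> vertices m" and w: "w \<in> vertices m" and w': "w' \<in> vertices m"
    and len: "length w = length w'" and par: "butlast w = butlast w'"
    and le: "length v \<le> length w" and ne: "length v = length w \<Longrightarrow> v \<noteq> w \<and> v \<noteq> w'"
  obtains g where "g \<in> H" "g v = v" "g w = w'"
proof -
  obtain x where x: "x \<in> boundary m" "pref x (length v) = v"
    using boundary_extension[OF v] .
  obtain y where y: "y \<in> boundary m" "pref y (length w) = w"
    using boundary_extension[OF w] .
  obtain y' where y': "y' \<in> boundary m" "pref y' (length w) = w'"
    using boundary_extension[OF w'] len by metis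
  have yk: "pref y k = pref y' k" if "k < length w" for k
  proof -
    have "pref y k = take k (butlast w)"
      using that y(2) take_pref[of k "length w" y] by (simp add: take_butlast)
    moreover have "pref y' k = take k (butlast w')"
      using that y'(2) take_pref[of k "length w" y'] len by (simp add: take_butlast)
    ultimately show ?thesis using par by simp
  qed
  show thesis
  proof (cases "pref y (length v) = v")
    case True
    then have lt: "length v < length w" using le ne y(2) by (metis le_neq_implies_less)
    obtain g where "g \<in> H" "\<And>n. g (pref y n) = pref y' n"
      using H_transitive_pairs[OF y(1) y(1) y'(1) y'(1)] by auto
    then show thesis using that[of g] True yk[OF lt] y(2) y'(2) by metis
  next
    case False
    have False': "pref y' (length v) \<noteq> v"
      using False yk[of "length v"] ne le y'(2) by (metis le_neq_implies_less)
    have "pref x k = pref y k \<longleftrightarrow> pref x k = pref y' k" for k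
    proof (cases "k < length w")
      case True
      then show ?thesis using yk by simp
    next
      case F: False
      then have "length v \<le> k" using le by simp
      then have "pref x k \<noteq> pref y k" "pref x k \<noteq> pref y' k"
        using x(2) False False' take_pref by metis+
      then show ?thesis by simp
    qed
    then obtain g where "g \<in> H" "\<And>n. g (pref x n) = pref x n" "\<And>n. g (pref y n) = pref y' n"
      using H_transitive_pairs[OF x(1) y(1) x(1) y'(1)] by auto
    then show thesis using that x(2) y(2) y'(2) by metis
  qed
qed

subsection \<open>Functions factoring through a level\<close>

text \<open>Pullback of a function on level \<open>n\<close> along the orbit map of the vertex
  \<open>pref \<xi> n\<close>. The value 0 outside \<open>H\<close> matches the convention of
  \<open>induced_trivial\<close>.\<close>

definition lift :: "nat \<Rightarrow> (nat list \<Rightarrow> complex) \<Rightarrow> (nat list \<Rightarrow> nat list) \<Rightarrow> complex" where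
  "lift n \<phi> = (\<lambda>x. if x \<in> H then \<phi> (x (pref \<xi> n)) else 0)"

definition U :: "nat \<Rightarrow> ((nat list \<Rightarrow> nat list) \<Rightarrow> complex) set" where
  "U n = range (lift n)"

lemma pref_base: "pref \<xi> n \<in> vertices m"
  by (rule pref_in_vertices[OF base])

lemma H_pref_base: "x \<in> H \<Longrightarrow> x (pref \<xi> n) \<in> level m n"
  using H_vertices H_length pref_base by simp

lemma lift_cong: "(\<And>w. w \<in> level m n \<Longrightarrow> \<phi> w = \<psi> w) \<Longrightarrow> lift n \<phi> = lift n \<psi>"
  using H_pref_base by (auto simp: lift_def fun_eq_iff)

text \<open>By transitivity the orbit of \<open>pref \<xi> n\<close> is the whole level, so the
  pullback loses no value on that level.\<close>

lemma lift_eq_iff: "lift n \<phi> = lift n \<psi> \<longleftrightarrow> (\<forall>w\<in>level m n. \<phi> w = \<psi> w)"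
proof
  assume eq: "lift n \<phi> = lift n \<psi>"
  show "\<forall>w\<in>level m n. \<phi> w = \<psi> w"
  proof
    fix w assume "w \<in> level m n"
    then obtain x where "x \<in> H" "x (pref \<xi> n) = w"
      using transitive_level[OF pref_base, of w n] by auto
    then show "\<phi> w = \<psi> w" using fun_cong[OF eq, of x] by (simp add: lift_def)
  qed
qed (blast intro: lift_cong)

lemma lift_add: "lift n (\<lambda>w. \<phi> w + \<psi> w) = lift n \<phi> + lift n \<psi>"
  by (auto simp: lift_def fun_eq_iff)

lemma lift_diff: "lift n (\<lambda>w. \<phi> w - \<psi> w) = lift n \<phi> - lift n \<psi>"
  by (auto simp: lift_def fun_eq_iff)

lemma lift_scale: "lift n (\<lambda>w. c * \<phi> w) = fscale c (lift n \<phi>)"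
  by (auto simp: lift_def fscale_def fun_eq_iff)

lemma lift_zero: "lift n (\<lambda>w. 0) = 0"
  by (auto simp: lift_def fun_eq_iff)

lemma lift_sum: "lift n (\<lambda>w. \<Sum>i\<in>I. \<phi> i w) = (\<Sum>i\<in>I. lift n (\<phi> i))"
  by (induction I rule: infinite_finite_induct) (simp_all add: lift_zero lift_add)

lemma lift_eq_0_iff: "lift n \<phi> = 0 \<longleftrightarrow> (\<forall>w\<in>level m n. \<phi> w = 0)"
  using lift_eq_iff[of n \<phi> "\<lambda>w. 0"] lift_zero by simp

lemma lift_Suc: "lift n \<phi> = lift (Suc n) (\<lambda>w. \<phi> (butlast w))"
  using H_butlast[OF _ pref_base, of _ "Suc n"] by (auto simp: lift_def fun_eq_iff butlast_pref_Suc)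

text \<open>Products apply the left factor first, so right translation by \<open>g\<close> moves the
  image of the base vertex by \<open>g\<close>.\<close>

lemma act_lift: "g \<in> H \<Longrightarrow> ract \<rho> g (lift n \<phi>) = lift n (\<lambda>w. \<phi> (g w))"
  using mult_H mult_eval[OF pref_base] by (auto simp: induced_trivial_def lift_def fun_eq_iff)

lemma U_lift: "lift n \<phi> \<in> U n"
  by (simp add: U_def)

lemma U_mono: "k \<le> n \<Longrightarrow> U k \<subseteq> U n"
proof (induction rule: dec_induct)
  case (step n)
  have "U n \<subseteq> U (Suc n)" unfolding U_def using lift_Suc by fast
  then show ?case using step by blast
qed simp

lemma subspace_U: "fs.subspace (U n)"
proof (rule fs.subspaceI)
  show "0 \<in> U n" using U_lift[of n "\<lambda>w. 0"] by (simp add: lift_zero)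
  show "\<And>x y. x \<in> U n \<Longrightarrow> y \<in> U n \<Longrightarrow> x + y \<in> U n"
    unfolding U_def by (auto simp flip: lift_add)
  show "\<And>c x. x \<in> U n \<Longrightarrow> fscale c x \<in> U n"
    unfolding U_def by (auto simp flip: lift_scale)
qed

section \<open>Compactness, and the induced space as a union of level spaces\<close>

lemma topspace_T: "topspace T = H"
  using closedin_subset[OF closed] by auto

lemma compact_T: "compact_space T"
  using closedin_compact_space[OF compact_space_aut_top closed] by (rule compact_space_subtopology)

lemma continuous_map_eval_T:
  "v \<in> vertices m \<Longrightarrow> continuous_map T (discrete_topology (vertices m)) (\<lambda>g. g v)"
  by (rule continuous_map_from_subtopology[OF continuous_map_eval])

lemma openin_eval:
  assumes "v \<in> vertices m" shows "openin T {y \<in> H. y v = w}"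
proof -
  have "openin T {y \<in> topspace T. y v \<in> {w} \<inter> vertices m}"
    by (rule openin_continuous_map_preimage[OF continuous_map_eval_T[OF assms]]) simp
  also have "{y \<in> topspace T. y v \<in> {w} \<inter> vertices m} = {y \<in> H. y v = w}"
    using H_vertices assms unfolding topspace_T by auto
  finally show ?thesis .
qed

lemma lift_in_X: "lift n \<phi> \<in> X"
proof -
  have "\<exists>N. openin T N \<and> x \<in> N \<and> (\<forall>y\<in>N. lift n \<phi> y = lift n \<phi> x)" if "x \<in> H" for x
    using that by (intro exI[of _ "{y \<in> H. y (pref \<xi> n) = x (pref \<xi> n)}"])
      (auto intro!: openin_eval pref_base simp: lift_def)
  moreover have "lift n \<phi> (h \<otimes>\<^bsub>G\<^esub> x) = lift n \<phi> x" if "h \<in> point_stabiliser H \<xi>" "x \<in> H" for h x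
  proof -
    have h: "h \<in> H" "bact h \<xi> = \<xi>" using that by (auto simp: point_stabiliser_def)
    then have "h (pref \<xi> n) = pref \<xi> n" using pref_bact[OF H_carrier base, of h n] by simp
    then show ?thesis
      using h that mult_H[of h x] mult_eval[OF pref_base, of h x n] by (simp add: lift_def)
  qed
  ultimately show ?thesis by (auto simp: induced_trivial_def lift_def)
qed

lemma X_locally_constant:
  assumes "f \<in> X"
  shows "\<forall>x\<in>H. \<exists>N. openin T N \<and> x \<in> N \<and> (\<forall>y\<in>N. f y = f x)"
  using assms by (simp add: induced_trivial_def)

text \<open>With \<open>z\<close> inverse to \<open>x\<close>, the product of \<open>y\<close> and
  \<open>z\<close> fixes every prefix of \<xi>, hence \<xi> itself. It therefore lies in the
  stabiliser, and left invariance of \<open>f\<close> compares \<open>x\<close> with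
  \<open>y\<close>.\<close>

lemma X_eq_of_pref_eq:
  assumes f: "f \<in> X" and x: "x \<in> H" and y: "y \<in> H" and eq: "\<And>n. x (pref \<xi> n) = y (pref \<xi> n)"
  shows "f x = f y"
proof -
  interpret group G by (rule group_G)
  obtain z where z: "z \<in> H" "x \<otimes>\<^bsub>G\<^esub> z = \<one>\<^bsub>G\<^esub>" "z \<otimes>\<^bsub>G\<^esub> x = \<one>\<^bsub>G\<^esub>"
    "\<And>v. v \<in> vertices m \<Longrightarrow> z (x v) = v"
    using H_inverse[OF x] by metis
  let ?h = "y \<otimes>\<^bsub>G\<^esub> z"
  have h: "?h \<in> H" using y z(1) by (rule mult_H)
  have "pref (bact ?h \<xi>) n = pref \<xi> n" for n
    using pref_bact[OF H_carrier[OF h] base] mult_eval[OF pref_base] eq z(4)[OF pref_base] by metis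
  then have "bact ?h \<xi> = \<xi>"
    by (rule boundary_eqI[OF bact_in_boundary[OF H_carrier[OF h] base] base])
  then have "?h \<in> point_stabiliser H \<xi>" using h by (simp add: point_stabiliser_def)
  then have "f (?h \<otimes>\<^bsub>G\<^esub> x) = f x" using f x by (simp add: induced_trivial_def)
  moreover have "?h \<otimes>\<^bsub>G\<^esub> x = y"
    using x y z m_assoc[of y z x] r_one[of y] by simp
  ultimately show ?thesis by simp
qed

text \<open>Otherwise the closed sets of pairs that \<open>f\<close> separates and level \<open>n\<close> does not would have
  a common point, although \<open>f\<close> does not separate group elements with the same image of \<open>\<xi>\<close>.\<close>

lemma X_uniform:
  assumes f: "f \<in> X"
  shows "\<exists>n. \<forall>x\<in>H. \<forall>y\<in>H. x (pref \<xi> n) = y (pref \<xi> n) \<longrightarrow> f x = f y"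
proof (rule ccontr)
  assume contr: "\<not> ?thesis"
  define C where "C n = {z \<in> topspace (prod_topology T T).
     fst z (pref \<xi> n) = snd z (pref \<xi> n) \<and> f (fst z) \<noteq> f (snd z)}" for n
  \<comment> \<open>Local constancy is continuity into a discrete space.\<close>
  have cf: "continuous_map T (discrete_topology UNIV) f"
    unfolding continuous_map_def
  proof (intro conjI allI impI)
    fix W
    show "openin T {x \<in> topspace T. f x \<in> W}"
      unfolding topspace_T
    proof (subst openin_subopen, rule ballI)
      fix x assume x: "x \<in> {x \<in> H. f x \<in> W}"
      then obtain N where N: "openin T N" "x \<in> N" "\<forall>y\<in>N. f y = f x"
        using X_locally_constant[OF f] by blast
      have "N \<subseteq> {x \<in> H. f x \<in> W}"
      proof
        fix y assume y: "y \<in> N"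
        then have "f y = f x" "y \<in> H"
          using N(3) openin_subset[OF N(1)] unfolding topspace_T by blast+
        then show "y \<in> {x \<in> H. f x \<in> W}" using x by simp
      qed
      then show "\<exists>N. openin T N \<and> x \<in> N \<and> N \<subseteq> {x \<in> H. f x \<in> W}"
        using N by blast
    qed
  qed simp
  have "closedin (prod_topology T T) (C n)" for n
  proof -
    let ?D = "discrete_topology (vertices m)" and ?E = "discrete_topology (UNIV :: complex set)"
    have e: "continuous_map T ?D (\<lambda>x. x (pref \<xi> n))"
      by (rule continuous_map_eval_T[OF pref_base])
    \<comment> \<open>Recording both images and both values of \<open>f\<close> at once turns
      \<open>C n\<close> into the preimage of a subset of a discrete space.\<close>
    have "continuous_map (prod_topology T T) (prod_topology (prod_topology ?D ?D) (prod_topology ?E ?E))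
       (\<lambda>z. ((fst z (pref \<xi> n), snd z (pref \<xi> n)), (f (fst z), f (snd z))))"
      by (intro continuous_map_pairedI continuous_map_compose[OF continuous_map_fst e, unfolded o_def]
          continuous_map_compose[OF continuous_map_snd e, unfolded o_def]
          continuous_map_compose[OF continuous_map_fst cf, unfolded o_def]
          continuous_map_compose[OF continuous_map_snd cf, unfolded o_def])
    then have "closedin (prod_topology T T) {z \<in> topspace (prod_topology T T).
      ((fst z (pref \<xi> n), snd z (pref \<xi> n)), (f (fst z), f (snd z))) \<in>
        {((a, b), (c, d)). a \<in> vertices m \<and> b \<in> vertices m \<and> a = b \<and> c \<noteq> d}}"
      by (rule closedin_continuous_map_preimage)
         (auto simp: prod_topology_discrete_topology[symmetric])
    also have "\<dots> = C n" using H_vertices[OF _ pref_base] by (auto simp: C_def topspace_T)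
    finally show ?thesis .
  qed
  moreover have "C n \<noteq> {}" for n
  proof -
    obtain x y where "x \<in> H" "y \<in> H" "x (pref \<xi> n) = y (pref \<xi> n)" "f x \<noteq> f y"
      using contr by blast
    then have "(x, y) \<in> C n" by (auto simp: C_def topspace_T simp del: topspace_subtopology)
    then show ?thesis by blast
  qed
  \<comment> \<open>Agreement on level \<open>n + 1\<close> passes to the parents, so the sets are
    nested and compactness yields a common point.\<close>
  moreover have "decseq C"
  proof (rule decseq_SucI, rule subsetI)
    fix n z assume z: "z \<in> C (Suc n)"
    then have H: "fst z \<in> H" "snd z \<in> H" by (auto simp: C_def topspace_T)
    have "fst z (pref \<xi> n) = snd z (pref \<xi> n)"
      using z H_butlast[OF H(1) pref_base, of "Suc n"] H_butlast[OF H(2) pref_base, of "Suc n"]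
      by (simp add: C_def butlast_pref_Suc)
    then show "z \<in> C n" using z by (auto simp: C_def)
  qed
  ultimately have "(\<Inter>n. C n) \<noteq> {}"
    using compact_space_imp_nest[of "prod_topology T T" C] compact_T
    by (simp add: compact_space_prod_topology)
  then obtain z where z: "\<And>n. z \<in> C n" by blast
  then have "fst z \<in> H" "snd z \<in> H" "f (fst z) \<noteq> f (snd z)" "\<And>n. fst z (pref \<xi> n) = snd z (pref \<xi> n)"
    using z topspace_T by (simp_all add: C_def mem_Times_iff)
  then show False using X_eq_of_pref_eq[OF f] by blast
qed

lemma X_eq_Union: "X = (\<Union>n. U n)"
proof
  show "X \<subseteq> (\<Union>n. U n)"
  proof
    fix f assume f: "f \<in> X"
    obtain n where n: "\<And>x y. x \<in> H \<Longrightarrow> y \<in> H \<Longrightarrow> x (pref \<xi> n) = y (pref \<xi> n) \<Longrightarrow> f x = f y"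
      using X_uniform[OF f] by blast
    \<comment> \<open>\<open>f\<close> is constant on the fibres of the orbit map, so any choice of
      \<open>y\<close> in the fibre over \<open>w\<close> gives the same value.\<close>
    have "f x = lift n (\<lambda>w. f (SOME y. y \<in> H \<and> y (pref \<xi> n) = w)) x" for x
    proof (cases "x \<in> H")
      case True
      let ?y = "SOME y. y \<in> H \<and> y (pref \<xi> n) = x (pref \<xi> n)"
      have "?y \<in> H \<and> ?y (pref \<xi> n) = x (pref \<xi> n)" by (rule someI[of _ x]) (simp add: True)
      then show ?thesis using n[of x ?y] True by (simp add: lift_def)
    next
      case False
      then show ?thesis using f by (simp add: lift_def induced_trivial_def)
    qed
    then show "f \<in> (\<Union>n. U n)" unfolding U_def by blast
  qed
  show "(\<Union>n. U n) \<subseteq> X" using lift_in_X by (auto simp: U_def)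
qed

section \<open>Smoothness of the induced representation\<close>

lemma subspace_X: "fs.subspace X"
proof (rule fs.subspaceI)
  show "0 \<in> X" using lift_in_X[of 0 "\<lambda>w. 0"] by (simp add: lift_zero)
  fix x y c assume "x \<in> X"
  then obtain k where k: "x \<in> U k" unfolding X_eq_Union by blast
  then show "fscale c x \<in> X" unfolding X_eq_Union using subspace_U fs.subspace_scale by blast
  assume "y \<in> X"
  then obtain l where "y \<in> U l" unfolding X_eq_Union by blast
  then have "x \<in> U (max k l)" "y \<in> U (max k l)"
    using k U_mono[of k "max k l"] U_mono[of l "max k l"] by auto
  then show "x + y \<in> X" unfolding X_eq_Union using subspace_U fs.subspace_add by blast
qed

lemma act_add: "ract \<rho> g (u + v) = ract \<rho> g u + ract \<rho> g v"
  by (auto simp: induced_trivial_def fun_eq_iff)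

lemma act_scale: "ract \<rho> g (fscale c v) = fscale c (ract \<rho> g v)"
  by (auto simp: induced_trivial_def fscale_def fun_eq_iff)

lemma act_mult:
  "g \<in> H \<Longrightarrow> h \<in> H \<Longrightarrow> ract \<rho> (g \<otimes>\<^bsub>G\<^esub> h) v = ract \<rho> g (ract \<rho> h v)"
proof -
  assume gh: "g \<in> H" "h \<in> H"
  have "x \<otimes>\<^bsub>G\<^esub> (g \<otimes>\<^bsub>G\<^esub> h) = x \<otimes>\<^bsub>G\<^esub> g \<otimes>\<^bsub>G\<^esub> h" if "x \<in> H" for x
    using monoid.m_assoc[OF group.is_monoid[OF group_G], of x g h] gh that by simp
  then show ?thesis using gh mult_H by (simp add: induced_trivial_def cong: if_cong)
qed

lemma act_one: "v \<in> X \<Longrightarrow> ract \<rho> \<one>\<^bsub>G\<^esub> v = v"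
proof -
  assume v: "v \<in> X"
  have "x \<otimes>\<^bsub>G\<^esub> \<one>\<^bsub>G\<^esub> = x" if "x \<in> H" for x
    using monoid.r_one[OF group.is_monoid[OF group_G], of x] that by simp
  moreover have "v x = 0" if "x \<notin> H" for x
    using v that by (simp add: induced_trivial_def)
  ultimately show ?thesis by (intro ext) (simp add: induced_trivial_def)
qed

lemma act_U: "g \<in> H \<Longrightarrow> f \<in> U n \<Longrightarrow> ract \<rho> g f \<in> U n"
  using act_lift U_lift by (auto simp: U_def)

lemma act_X: "g \<in> H \<Longrightarrow> f \<in> X \<Longrightarrow> ract \<rho> g f \<in> X"
  using act_U unfolding X_eq_Union by blast

lemma is_rep_sub:
  assumes "fs.subspace W" "W \<subseteq> X" "\<And>g f. g \<in> H \<Longrightarrow> f \<in> W \<Longrightarrow> ract \<rho> g f \<in> W"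
  shows "is_rep G (restrict_rep \<rho> W)"
  unfolding is_rep_def linear_between_def
proof (intro conjI ballI allI)
  show "ract (restrict_rep \<rho> W) \<one>\<^bsub>G\<^esub> v = v" if "v \<in> rspace (restrict_rep \<rho> W)" for v
    using act_one[of v] that assms(2) by auto
  show "ract (restrict_rep \<rho> W) (g \<otimes>\<^bsub>G\<^esub> h) v = ract (restrict_rep \<rho> W) g (ract (restrict_rep \<rho> W) h v)"
    if "g \<in> carrier G" "h \<in> carrier G" for g h v
    using act_mult[of g h v] that by simp
qed (use assms(1,3) in \<open>auto simp: act_add act_scale\<close>)

text \<open>If \<open>f\<close> comes from level \<open>n\<close>, its translate by \<open>g\<close>
  depends only on the values of \<open>g\<close> on that finite level. Elements agreeing with
  \<open>g\<close> there form a neighbourhood of \<open>g\<close>.\<close>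

lemma openin_stabiliser: "f \<in> X \<Longrightarrow> openin T {g \<in> H. ract \<rho> g f = f}"
proof -
  assume "f \<in> X"
  then obtain n \<phi> where f: "f = lift n \<phi>" by (auto simp: X_eq_Union U_def)
  show ?thesis
    unfolding openin_subopen[of T "{g \<in> H. ract \<rho> g f = f}"]
  proof
    fix g assume g: "g \<in> {g \<in> H. ract \<rho> g f = f}"
    let ?N = "topspace T \<inter> (\<Inter>v\<in>level m n. {y \<in> H. y v = g v})"
    have "openin T ?N"
      using openin_INT[OF finite_level, of m n T "\<lambda>v. {y \<in> H. y v = g v}"] openin_eval
      by (simp add: Int_commute)
    moreover have "g \<in> ?N" using g topspace_T by auto
    moreover have "ract \<rho> h f = f" if h: "h \<in> ?N" for h
    proof -
      have hH: "h \<in> H" using h topspace_T by auto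
      have gH: "g \<in> H" using g by simp
      have "ract \<rho> h f = ract \<rho> g f"
        unfolding f act_lift[OF hH] act_lift[OF gH] by (rule lift_cong) (use h in auto)
      then show ?thesis using g by simp
    qed
    ultimately show "\<exists>N. openin T N \<and> g \<in> N \<and> N \<subseteq> {g \<in> H. ract \<rho> g f = f}"
      using topspace_T by (intro exI[of _ ?N]) auto
  qed
qed

text \<open>Stated for a subspace so that it serves both the whole induced space and each
  constituent.\<close>

lemma smooth_sub:
  assumes "fs.subspace W" "W \<subseteq> X" "\<And>g f. g \<in> H \<Longrightarrow> f \<in> W \<Longrightarrow> ract \<rho> g f \<in> W"
  shows "smooth_rep G T (restrict_rep \<rho> W)"
  using is_rep_sub[OF assms] openin_stabiliser assms(2) by (auto simp: smooth_rep_def)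

lemma smooth_rho: "smooth_rep G T \<rho>"
  using smooth_sub[OF subspace_X subset_refl act_X] by simp

end

subsection \<open>The constituents\<close>

text \<open>The root has to be excluded because \<open>butlast []\<close> is again
  \<open>[]\<close>.\<close>

definition children :: "(nat \<Rightarrow> nat) \<Rightarrow> nat list \<Rightarrow> nat list set" where
  "children m p = {w \<in> vertices m. w \<noteq> [] \<and> butlast w = p}"

context boundary_transitive
begin

lemma children_eq_image:
  assumes "p \<in> vertices m"
  shows "children m p = (\<lambda>i. p @ [i]) ` {..<m (Suc (length p))}"
proof (intro equalityI subsetI)
  fix w assume "w \<in> children m p"
  then have "w = p @ [last w]" "w \<in> vertices m" by (auto simp: children_def)
  then show "w \<in> (\<lambda>i. p @ [i]) ` {..<m (Suc (length p))}"
    by (metis append_in_vertices_iff imageI lessThan_iff)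
qed (use assms in \<open>auto simp: children_def append_in_vertices_iff\<close>)

lemma inj_append_single: "inj_on (\<lambda>i. p @ [i]) A"
  by (simp add: inj_on_def)

lemma finite_children: "p \<in> vertices m \<Longrightarrow> finite (children m p)"
  by (simp add: children_eq_image)

lemma card_children: "p \<in> vertices m \<Longrightarrow> card (children m p) = m (Suc (length p))"
  by (simp add: children_eq_image card_image inj_append_single)

lemma children_subset_level: "p \<in> level m n \<Longrightarrow> children m p \<subseteq> level m (Suc n)"
  by (auto simp: children_def)

lemma butlast_in_level: "w \<in> level m (Suc n) \<Longrightarrow> butlast w \<in> level m n"
  by (auto simp: butlast_in_vertices)

lemma in_children_butlast: "w \<in> level m (Suc n) \<Longrightarrow> w \<in> children m (butlast w)"
  by (auto simp: children_def)

text \<open>An injection between finite sets of equal size: the number of children depends only on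
  the level.\<close>

lemma bij_betw_children:
  assumes g: "g \<in> H" and p: "p \<in> vertices m"
  shows "bij_betw g (children m p) (children m (g p))"
proof -
  have inj: "inj_on g (children m p)"
    using H_inj[OF g] by (rule inj_on_subset) (auto simp: children_def)
  have "g w \<in> children m (g p)" if w: "w \<in> children m p" for w
  proof -
    have "w \<in> vertices m" "w \<noteq> []" "butlast w = p" using w by (auto simp: children_def)
    then show ?thesis
      using H_vertices[OF g] H_length[OF g, of w] H_butlast[OF g, of w]
      by (auto simp: children_def)
  qed
  then have "g ` children m p \<subseteq> children m (g p)" by blast
  moreover have "card (g ` children m p) = card (children m (g p))"
    using p g by (simp add: card_image[OF inj] card_children H_vertices H_length)
  ultimately have "g ` children m p = children m (g p)"
    by (rule card_subset_eq[OF finite_children[OF H_vertices[OF g p]]])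
  then show ?thesis using inj by (simp add: bij_betw_def)
qed

definition csum :: "(nat list \<Rightarrow> complex) \<Rightarrow> nat list \<Rightarrow> complex" where
  "csum \<phi> p = (\<Sum>w\<in>children m p. \<phi> w)"

lemma csum_act: "g \<in> H \<Longrightarrow> p \<in> vertices m \<Longrightarrow> csum (\<lambda>w. \<phi> (g w)) p = csum \<phi> (g p)"
  unfolding csum_def by (rule sum.reindex_bij_betw[OF bij_betw_children])

lemma csum_cong:
  assumes "p \<in> level m n" "\<And>w. w \<in> level m (Suc n) \<Longrightarrow> \<phi> w = \<psi> w"
  shows "csum \<phi> p = csum \<psi> p"
  unfolding csum_def using assms children_subset_level[OF assms(1)] by (intro sum.cong) blast+

lemma csum_constant:
  assumes p: "p \<in> level m n" and c: "\<And>w. w \<in> children m p \<Longrightarrow> \<phi> w = c"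
  shows "csum \<phi> p = of_nat (m (Suc n)) * c"
  using p unfolding csum_def by (simp add: sum.cong[OF refl c] card_children)

text \<open>\<open>V 0\<close> consists of the constants on \<open>H\<close>. For
  \<open>n > 0\<close> the vanishing child sums say that the function on level \<open>n\<close> is
  orthogonal, for the counting inner product, to everything pulled back from level
  \<open>n - 1\<close>.\<close>

definition V :: "nat \<Rightarrow> ((nat list \<Rightarrow> nat list) \<Rightarrow> complex) set" where
  "V n = (case n of 0 \<Rightarrow> U 0 | Suc k \<Rightarrow> {lift (Suc k) \<phi> | \<phi>. \<forall>p\<in>level m k. csum \<phi> p = 0})"

lemma V_0: "V 0 = U 0"
  by (simp add: V_def)

lemma V_SucE:
  assumes "f \<in> V (Suc n)"
  obtains \<phi> where "f = lift (Suc n) \<phi>" "\<forall>p\<in>level m n. csum \<phi> p = 0"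
  using assms unfolding V_def nat.case by blast

lemma lift_in_V: "(\<And>p. p \<in> level m n \<Longrightarrow> csum \<phi> p = 0) \<Longrightarrow> lift (Suc n) \<phi> \<in> V (Suc n)"
  unfolding V_def nat.case by blast

text \<open>The child sums see only values on level \<open>n + 1\<close>, so they vanish for every
  function representing the same vector.\<close>

lemma lift_in_VD:
  assumes "lift (Suc n) \<phi> \<in> V (Suc n)" "p \<in> level m n"
  shows "csum \<phi> p = 0"
proof -
  obtain \<psi> where \<psi>: "lift (Suc n) \<phi> = lift (Suc n) \<psi>" "\<forall>p\<in>level m n. csum \<psi> p = 0"
    using V_SucE[OF assms(1)] by blast
  then have "csum \<phi> p = csum \<psi> p"
    using csum_cong[OF assms(2)] lift_eq_iff by blast
  then show ?thesis using \<psi>(2) assms(2) by simp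
qed

lemma V_subset_U: "V n \<subseteq> U n"
  by (cases n) (auto simp: V_0 U_lift elim!: V_SucE)

lemma U_subset_X: "U n \<subseteq> X"
  unfolding X_eq_Union by blast

lemma V_subset_X: "V n \<subseteq> X"
  using V_subset_U U_subset_X by blast

lemma subspace_V: "fs.subspace (V n)"
proof (cases n)
  case 0
  then show ?thesis by (simp add: V_0 subspace_U)
next
  case (Suc k)
  show ?thesis unfolding Suc
  proof (rule fs.subspaceI)
    show "0 \<in> V (Suc k)"
      using lift_in_V[of k "\<lambda>w. 0"] by (simp add: lift_zero csum_def)
    fix x c assume "x \<in> V (Suc k)"
    then obtain \<phi> where \<phi>: "x = lift (Suc k) \<phi>" "\<forall>p\<in>level m k. csum \<phi> p = 0"
      using V_SucE by blast
    show "fscale c x \<in> V (Suc k)"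
      unfolding \<phi>(1) lift_scale[symmetric]
      by (rule lift_in_V) (use \<phi>(2) in \<open>simp add: csum_def flip: sum_distrib_left\<close>)
    fix y assume "y \<in> V (Suc k)"
    then obtain \<psi> where \<psi>: "y = lift (Suc k) \<psi>" "\<forall>p\<in>level m k. csum \<psi> p = 0"
      using V_SucE by blast
    show "x + y \<in> V (Suc k)"
      unfolding \<phi>(1) \<psi>(1) lift_add[symmetric]
      by (rule lift_in_V) (use \<phi>(2) \<psi>(2) in \<open>simp add: csum_def sum.distrib\<close>)
  qed
qed

lemma act_V: "g \<in> H \<Longrightarrow> f \<in> V n \<Longrightarrow> ract \<rho> g f \<in> V n"
proof (cases n)
  case 0
  then show "g \<in> H \<Longrightarrow> f \<in> V n \<Longrightarrow> ract \<rho> g f \<in> V n" by (simp add: V_0 act_U)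
next
  case (Suc k)
  assume g: "g \<in> H" and f: "f \<in> V n"
  then obtain \<phi> where \<phi>: "f = lift (Suc k) \<phi>" "\<forall>p\<in>level m k. csum \<phi> p = 0"
    unfolding Suc using V_SucE by blast
  show ?thesis unfolding Suc \<phi>(1) act_lift[OF g]
    by (rule lift_in_V) (use \<phi>(2) g H_vertices H_length in \<open>simp add: csum_act\<close>)
qed

lemma invariantI:
  assumes "fs.subspace W" "W \<subseteq> X" "\<And>g f. g \<in> H \<Longrightarrow> f \<in> W \<Longrightarrow> ract \<rho> g f \<in> W"
  shows "invariant G \<rho> W"
  using assms unfolding invariant_def by auto

lemma invariantD:
  assumes "invariant G \<rho> W"
  shows "fs.subspace W" "W \<subseteq> X" "\<And>g f. g \<in> H \<Longrightarrow> f \<in> W \<Longrightarrow> ract \<rho> g f \<in> W"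
  using assms unfolding invariant_def by auto

lemma invariant_V: "invariant G \<rho> (V n)"
  by (rule invariantI[OF subspace_V V_subset_X act_V])

lemma invariant_U: "invariant G \<rho> (U n)"
  by (rule invariantI[OF subspace_U U_subset_X act_U])

text \<open>A function pulled back from level \<open>n\<close> is constant on the children of
  \<open>p\<close>, so its child sum is \<open>m (Suc n)\<close> times its value at
  \<open>p\<close>.\<close>

lemma V_Suc_Int_U:
  assumes "f \<in> V (Suc n)" "f \<in> U n"
  shows "f = 0"
proof -
  obtain \<psi> where \<psi>: "f = lift n \<psi>" using assms(2) by (auto simp: U_def)
  have "\<psi> p = 0" if p: "p \<in> level m n" for p
  proof -
    have "csum (\<lambda>w. \<psi> (butlast w)) p = 0"
      using assms(1) p unfolding \<psi> lift_Suc[of n] by (rule lift_in_VD)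
    moreover have "csum (\<lambda>w. \<psi> (butlast w)) p = of_nat (m (Suc n)) * \<psi> p"
      by (rule csum_constant[OF p]) (simp add: children_def)
    ultimately show ?thesis using branching[of "Suc n"] by auto
  qed
  then show ?thesis unfolding \<psi> lift_eq_0_iff by blast
qed

lemma U_Suc_split:
  assumes "f \<in> U (Suc n)"
  obtains u where "u \<in> U n" "f - u \<in> V (Suc n)"
proof -
  obtain \<phi> where \<phi>: "f = lift (Suc n) \<phi>" using assms by (auto simp: U_def)
  \<comment> \<open>The mean over the children of \<open>p\<close>; subtracting it makes every child
    sum vanish.\<close>
  let ?a = "\<lambda>p. csum \<phi> p / of_nat (m (Suc n))"
  have "f - lift n ?a = lift (Suc n) (\<lambda>w. \<phi> w - ?a (butlast w))"
    unfolding \<phi> lift_diff lift_Suc[of n] ..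
  also have "\<dots> \<in> V (Suc n)"
  proof (rule lift_in_V)
    fix p assume p: "p \<in> level m n"
    have "csum (\<lambda>w. \<phi> w - ?a (butlast w)) p = csum \<phi> p - csum (\<lambda>w. ?a (butlast w)) p"
      by (simp only: csum_def sum_subtractf)
    also have "csum (\<lambda>w. ?a (butlast w)) p = of_nat (m (Suc n)) * ?a p"
      by (rule csum_constant[OF p]) (simp add: children_def)
    finally show "csum (\<lambda>w. \<phi> w - ?a (butlast w)) p = 0"
      using branching[of "Suc n"] by simp
  qed
  finally show thesis using that[OF U_lift] by blast
qed

section \<open>Vectors fixed by a vertex stabiliser, and averaging\<close>

definition fixed :: "nat list \<Rightarrow> ((nat list \<Rightarrow> nat list) \<Rightarrow> complex) \<Rightarrow> bool" where
  "fixed v f \<longleftrightarrow> (\<forall>g\<in>H. g v = v \<longrightarrow> ract \<rho> g f = f)"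

lemma fixed_lift_eq:
  assumes "fixed v (lift n \<phi>)" "g \<in> H" "g v = v" "w \<in> level m n"
  shows "\<phi> (g w) = \<phi> w"
proof -
  have "lift n (\<lambda>w. \<phi> (g w)) = lift n \<phi>"
    using assms(1-3) act_lift[OF assms(2), of n \<phi>] by (auto simp: fixed_def)
  then show ?thesis using assms(4) unfolding lift_eq_iff by blast
qed

lemma fixed_siblings:
  assumes "fixed v (lift n \<phi>)" "v \<in> vertices m" "length v \<le> n"
    and "w \<in> level m n" "w' \<in> level m n" "butlast w = butlast w'"
    and "length v = n \<Longrightarrow> v \<noteq> w \<and> v \<noteq> w'"
  shows "\<phi> w = \<phi> w'"
proof -
  obtain g where "g \<in> H" "g v = v" "g w = w'"
    using stabiliser_transitive_siblings[of v w w'] assms(2-7) by auto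
  then show ?thesis using fixed_lift_eq[OF assms(1) _ _ assms(4)] by metis
qed

text \<open>The stabiliser of \<open>v\<close> moves any vertex of level \<open>n + 1\<close> to each of its siblings.\<close>

lemma fixed_below:
  assumes f: "f \<in> U (Suc n)" and v: "v \<in> vertices m" "length v \<le> n" and fx: "fixed v f"
  shows "f \<in> U n"
proof -
  obtain \<phi> where \<phi>: "f = lift (Suc n) \<phi>" using f by (auto simp: U_def)
  have "lift (Suc n) \<phi> = lift n (\<lambda>p. \<phi> (p @ [0]))"
    unfolding lift_Suc[of n]
  proof (rule lift_cong)
    fix w assume w: "w \<in> level m (Suc n)"
    \<comment> \<open>The child with letter 0 serves as representative of each family of
      siblings.\<close>
    have "butlast w @ [0] \<in> level m (Suc n)"
      using butlast_in_level[OF w] branching[of "Suc n"] by (auto simp: append_in_vertices_iff)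
    then show "\<phi> w = \<phi> (butlast w @ [0])"
      using fixed_siblings[of v "Suc n" \<phi> w "butlast w @ [0]"] fx v w unfolding \<phi> by simp
  qed
  then show ?thesis unfolding \<phi> using U_lift by metis
qed

lemma act_sum: "ract \<rho> g (\<Sum>A) = (\<Sum>s\<in>A. ract \<rho> g s)"
proof (induction A rule: infinite_finite_induct)
  case (insert x A)
  then show ?case by (simp only: sum.insert[OF insert.hyps] act_add)
qed (auto simp: induced_trivial_def fun_eq_iff)

text \<open>Averaging over a stabiliser is a finite sum: only finitely many translates of a function
  factoring through a level are distinct.\<close>

lemma stabiliser_average:
  assumes v: "v \<in> vertices m"
  obtains I where "finite I" "I \<noteq> {}" "\<And>g. g \<in> I \<Longrightarrow> g \<in> H \<and> g v = v"
    "fixed v (lift n (\<lambda>w. \<Sum>g\<in>I. \<phi> (g w)))"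
proof -
  let ?A = "{g \<in> H. g v = v}" and ?f = "lift n \<phi>"
  let ?S = "(\<lambda>g. ract \<rho> g ?f) ` ?A"
  \<comment> \<open>A translate is determined by the restriction of \<open>g\<close> to the finite
    level, which leaves finitely many possibilities.\<close>
  have "?S \<subseteq> (\<lambda>h. lift n (\<lambda>w. \<phi> (h w))) ` (level m n \<rightarrow>\<^sub>E level m n)"
  proof (rule image_subsetI)
    fix g assume "g \<in> ?A"
    then have g: "g \<in> H" by simp
    have "ract \<rho> g ?f = lift n (\<lambda>w. \<phi> (restrict g (level m n) w))"
      unfolding act_lift[OF g] by (rule lift_cong) simp
    moreover have "restrict g (level m n) \<in> level m n \<rightarrow>\<^sub>E level m n"
      using H_vertices[OF g] H_length[OF g] by auto
    ultimately show "ract \<rho> g ?f \<in> (\<lambda>h. lift n (\<lambda>w. \<phi> (h w))) ` (level m n \<rightarrow>\<^sub>E level m n)"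
      by blast
  qed
  then have finS: "finite ?S"
    by (rule finite_subset) (intro finite_imageI finite_PiE finite_level)
  \<comment> \<open>One group element is kept for each distinct translate.\<close>
  obtain I where I: "I \<subseteq> ?A" "inj_on (\<lambda>g. ract \<rho> g ?f) I" "?S = (\<lambda>g. ract \<rho> g ?f) ` I"
    using subset_image_inj[of ?S "\<lambda>g. ract \<rho> g ?f" ?A] by auto
  have "finite I" using finS I(2) unfolding I(3) by (rule finite_imageD)
  moreover have "\<one>\<^bsub>G\<^esub> \<in> ?A" using one_H one_eval[OF v] by blast
  then have "I \<noteq> {}" using I(3) by blast
  moreover have eq: "lift n (\<lambda>w. \<Sum>g\<in>I. \<phi> (g w)) = \<Sum>?S"
  proof -
    have "\<Sum>?S = (\<Sum>g\<in>I. ract \<rho> g ?f)"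
      unfolding I(3) using I(2) by (simp add: sum.reindex)
    also have "\<dots> = (\<Sum>g\<in>I. lift n (\<lambda>w. \<phi> (g w)))"
      using I(1) by (intro sum.cong refl act_lift) blast
    finally show ?thesis by (simp add: lift_sum)
  qed
  \<comment> \<open>Each element of the stabiliser maps the finite set \<open>?S\<close> into
    itself, injectively since it is invertible. It therefore permutes \<open>?S\<close> and fixes
    the sum.\<close>
  have "fixed v (\<Sum>?S)"
    unfolding fixed_def
  proof (intro ballI impI)
    fix g assume g: "g \<in> H" "g v = v"
    have into: "ract \<rho> g s \<in> ?S" if "s \<in> ?S" for s
    proof -
      obtain h where h: "h \<in> ?A" "s = ract \<rho> h ?f" using \<open>s \<in> ?S\<close> by blast
      then have "ract \<rho> g s = ract \<rho> (g \<otimes>\<^bsub>G\<^esub> h) ?f"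
        using g by (simp only: act_mult mem_Collect_eq)
      moreover have "g \<otimes>\<^bsub>G\<^esub> h \<in> ?A" using g h mult_H[of g h] mult_eval[OF v, of g h] by simp
      ultimately show ?thesis by blast
    qed
    have SX: "s \<in> X" if "s \<in> ?S" for s
      using that act_X lift_in_X by blast
    obtain k where k: "k \<in> H" "k \<otimes>\<^bsub>G\<^esub> g = \<one>\<^bsub>G\<^esub>"
      using H_inverse[OF g(1)] by metis
    have "inj_on (ract \<rho> g) ?S"
    proof (rule inj_on_inverseI)
      fix s assume "s \<in> ?S"
      then show "ract \<rho> k (ract \<rho> g s) = s"
        using act_mult[OF k(1) g(1), of s] k(2) act_one[OF SX] by simp
    qed
    moreover from this have "ract \<rho> g ` ?S = ?S"
      using into finS by (intro endo_inj_surj) blast+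
    moreover have "ract \<rho> g (\<Sum>?S) = (\<Sum>s\<in>?S. ract \<rho> g s)"
      by (rule act_sum)
    ultimately show "ract \<rho> g (\<Sum>?S) = \<Sum>?S"
      using sum.reindex[of "ract \<rho> g" ?S "\<lambda>s. s"] by (simp only: o_def)
  qed
  ultimately show thesis using that[of I] I(1) eq by auto
qed

lemma average_in_invariant:
  assumes W: "invariant G \<rho> W" and f: "lift n \<phi> \<in> W" and I: "\<And>g. g \<in> I \<Longrightarrow> g \<in> H"
  shows "lift n (\<lambda>w. \<Sum>g\<in>I. \<phi> (g w)) \<in> W"
proof -
  have "lift n (\<lambda>w. \<phi> (g w)) \<in> W" if "g \<in> I" for g
    using invariantD(3)[OF W I f] act_lift[OF I] that by metis
  then show ?thesis
    unfolding lift_sum by (rule fs.subspace_sum[OF invariantD(1)[OF W]])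
qed

text \<open>Source of fixed vectors, both for irreducibility and for telling the constituents apart.
  The vertex \<open>v\<close> is chosen where \<open>f\<close> does not vanish, so that averaging
  over its stabiliser cannot produce 0.\<close>

lemma invariant_contains_fixed:
  assumes W: "invariant G \<rho> W" and f: "f \<in> W" "f \<in> U n" "f \<noteq> 0"
  obtains v \<psi> where "v \<in> level m n" "lift n \<psi> \<in> W" "fixed v (lift n \<psi>)" "\<psi> v \<noteq> 0"
proof -
  obtain \<phi> where \<phi>: "f = lift n \<phi>" using f(2) by (auto simp: U_def)
  then obtain v where v: "v \<in> level m n" "\<phi> v \<noteq> 0"
    using f(3) lift_eq_0_iff by blast
  then obtain I where I: "finite I" "I \<noteq> {}" "\<And>g. g \<in> I \<Longrightarrow> g \<in> H \<and> g v = v"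
    "fixed v (lift n (\<lambda>w. \<Sum>g\<in>I. \<phi> (g w)))"
    using stabiliser_average[of v n \<phi>] by blast
  \<comment> \<open>Every \<open>g\<close> in \<open>I\<close> fixes \<open>v\<close>, so the sum at
    \<open>v\<close> is \<open>card I\<close> times the nonzero value
    \<open>\<phi> v\<close>.\<close>
  have "(\<Sum>g\<in>I. \<phi> (g v)) = (\<Sum>g\<in>I. \<phi> v)"
    by (rule sum.cong) (simp_all add: I(3))
  then have "(\<Sum>g\<in>I. \<phi> (g v)) \<noteq> 0" using I(1,2) v(2) by simp
  then show thesis
    using that[OF v(1) _ I(4)] average_in_invariant[OF W, of n \<phi> I] f(1) I(3) \<phi> by blast
qed

subsection \<open>Irreducibility\<close>

lemma lift_0_eq: "lift 0 \<phi> = fscale (\<phi> []) (lift 0 (\<lambda>w. 1))"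
  unfolding lift_scale[symmetric] by (rule lift_cong) simp

text \<open>For \<open>v\<close> other than the root this is \<open>m (length v)\<close> times the
  orthogonal projection of the indicator of \<open>v\<close> to functions with vanishing child sums:
  a zonal spherical function for the stabiliser of \<open>v\<close>.\<close>

definition zonal :: "nat list \<Rightarrow> nat list \<Rightarrow> complex" where
  "zonal v w = (if w = v then of_nat (m (length v)) else 0) - (if butlast w = butlast v then 1 else 0)"

lemma zonal_act:
  assumes "g \<in> H" "v \<in> level m n" "v' \<in> level m n" "g v' = v" "w \<in> level m n"
  shows "zonal v (g w) = zonal v' w"
proof -
  have "g w = v \<longleftrightarrow> w = v'"
    using inj_onD[OF H_inj[OF assms(1)], of w v'] assms by auto
  moreover have "butlast (g w) = butlast v \<longleftrightarrow> butlast w = butlast v'"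
  proof -
    have "butlast (g w) = g (butlast w)" "butlast v = g (butlast v')"
      using H_butlast[OF assms(1)] assms by auto
    then show ?thesis
      using inj_onD[OF H_inj[OF assms(1)], of "butlast w" "butlast v'"] assms butlast_in_vertices
      by auto
  qed
  ultimately show ?thesis using assms(2,3) by (simp add: zonal_def)
qed

text \<open>A fixed vector is constant on each family of siblings not containing \<open>v\<close>,
  and vanishing child sums make that constant 0. In the family of \<open>v\<close> the other
  siblings share one value, and the child sum determines the value at \<open>v\<close> from it. So
  only a line remains.\<close>

lemma fixed_in_V_zonal:
  assumes \<psi>: "lift (Suc n) \<psi> \<in> V (Suc n)" and v: "v \<in> level m (Suc n)" "\<psi> v \<noteq> 0"
    and fx: "fixed v (lift (Suc n) \<psi>)"
  obtains c where "c \<noteq> 0" "lift (Suc n) (zonal v) = fscale c (lift (Suc n) \<psi>)"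
proof -
  let ?p = "butlast v"
  have p: "?p \<in> level m n" and vp: "v \<in> children m ?p"
    using v(1) by (rule butlast_in_level, rule in_children_butlast)
  have m2: "m (Suc n) \<ge> 2" using branching by simp
  have "card (children m ?p - {v}) \<noteq> 0"
    using p vp m2 card_children[of ?p] by (simp add: finite_children)
  then have "children m ?p - {v} \<noteq> {}" by (metis card.empty)
  then obtain w0 where w0: "w0 \<in> children m ?p" "w0 \<noteq> v" by blast
  have sib: "\<psi> w = \<psi> w0" if w: "w \<in> children m ?p" "w \<noteq> v" for w
  proof (rule fixed_siblings[OF fx])
    show "w \<in> level m (Suc n)" "w0 \<in> level m (Suc n)"
      using w w0 children_subset_level[OF p] by blast+
    show "butlast w = butlast w0" using w w0 by (simp add: children_def)
  qed (use v w w0 in auto)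
  have "csum \<psi> ?p = 0" using \<psi> p by (rule lift_in_VD)
  moreover have "csum \<psi> ?p = \<psi> v + (\<Sum>w\<in>children m ?p - {v}. \<psi> w)"
    unfolding csum_def using vp p by (intro sum.remove finite_children) auto
  moreover have "(\<Sum>w\<in>children m ?p - {v}. \<psi> w) = (\<Sum>w\<in>children m ?p - {v}. \<psi> w0)"
    by (rule sum.cong) (use sib in auto)
  moreover have "card (children m ?p - {v}) = m (Suc n) - 1"
    using p vp card_children[of ?p] by (simp add: finite_children)
  ultimately have vv: "\<psi> v = - (of_nat (m (Suc n)) - 1) * \<psi> w0"
    using m2 by (simp add: algebra_simps of_nat_diff eq_neg_iff_add_eq_0)
  then have w0_ne: "\<psi> w0 \<noteq> 0" using v(2) by auto
  \<comment> \<open>The factor is dictated by the siblings of \<open>v\<close>, where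
    \<open>zonal v\<close> is -1 and \<psi> is \<open>\<psi> w0\<close>.\<close>
  have "lift (Suc n) (zonal v) = lift (Suc n) (\<lambda>w. (- 1 / \<psi> w0) * \<psi> w)"
  proof (rule lift_cong)
    fix w assume w: "w \<in> level m (Suc n)"
    consider "w = v" | "w \<noteq> v" "butlast w = ?p" | "butlast w \<noteq> ?p" by blast
    then show "zonal v w = (- 1 / \<psi> w0) * \<psi> w"
    proof cases
      case 1
      then show ?thesis using vv w0_ne v(1) by (simp add: zonal_def field_simps)
    next
      case 2
      then have "\<psi> w = \<psi> w0" using sib in_children_butlast[OF w] by simp
      then show ?thesis using 2 w0_ne by (simp add: zonal_def)
    next
      case 3
      have q: "butlast w \<in> level m n" using w by (rule butlast_in_level)
      have "\<psi> u = \<psi> w" if u: "u \<in> children m (butlast w)" for u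
      proof (rule fixed_siblings[OF fx])
        show "u \<in> level m (Suc n)" using u children_subset_level[OF q] by blast
        show "butlast u = butlast w" using u by (simp add: children_def)
        then show "v \<noteq> u \<and> v \<noteq> w" using 3 by auto
      qed (use v w in auto)
      then have "csum \<psi> (butlast w) = of_nat (m (Suc n)) * \<psi> w"
        by (rule csum_constant[OF q])
      moreover have "csum \<psi> (butlast w) = 0" using \<psi> q by (rule lift_in_VD)
      ultimately have "\<psi> w = 0" using m2 by auto
      then show ?thesis using 3 by (auto simp: zonal_def)
    qed
  qed
  moreover have "- 1 / \<psi> w0 \<noteq> 0" using w0_ne by simp
  ultimately show thesis using that unfolding lift_scale by blast
qed

text \<open>At \<open>w\<close> the sum of \<open>\<phi> v * zonal v w\<close> equals
  \<open>m (Suc n) * \<phi> w\<close> minus the sum of \<phi> over \<open>w\<close> and its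
  siblings, and the latter vanishes. Hence the zonal functions span.\<close>

lemma zonal_expansion:
  assumes \<phi>: "lift (Suc n) \<phi> \<in> V (Suc n)"
  shows "lift (Suc n) \<phi> =
    fscale (1 / of_nat (m (Suc n))) (\<Sum>v\<in>level m (Suc n). fscale (\<phi> v) (lift (Suc n) (zonal v)))"
  unfolding lift_scale[symmetric] lift_sum[symmetric]
proof (rule lift_cong)
  fix w assume w: "w \<in> level m (Suc n)"
  let ?L = "level m (Suc n)"
  have "(\<Sum>v\<in>?L. \<phi> v * zonal v w) =
    (\<Sum>v\<in>?L. (if v = w then of_nat (m (Suc n)) * \<phi> w else 0) - (if v \<in> children m (butlast w) then \<phi> v else 0))"
  proof (rule sum.cong[OF refl])
    fix v assume v: "v \<in> ?L"
    then have "v \<in> children m (butlast w) \<longleftrightarrow> butlast w = butlast v"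
      by (auto simp: children_def)
    then show "\<phi> v * zonal v w =
      (if v = w then of_nat (m (Suc n)) * \<phi> w else 0) - (if v \<in> children m (butlast w) then \<phi> v else 0)"
      using v by (auto simp: zonal_def algebra_simps)
  qed
  also have "\<dots> = of_nat (m (Suc n)) * \<phi> w - (\<Sum>v\<in>?L \<inter> children m (butlast w). \<phi> v)"
    using w by (simp only: sum_subtractf sum.delta finite_level sum.inter_restrict if_True)
  also have "?L \<inter> children m (butlast w) = children m (butlast w)"
    using children_subset_level[OF butlast_in_level[OF w]] by blast
  also have "(\<Sum>v\<in>children m (butlast w). \<phi> v) = 0"
    using lift_in_VD[OF \<phi> butlast_in_level[OF w]] by (simp add: csum_def)
  finally show "\<phi> w = 1 / of_nat (m (Suc n)) * (\<Sum>v\<in>?L. \<phi> v * zonal v w)"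
    using branching[of "Suc n"] by simp
qed

text \<open>A nonzero invariant subspace contains a fixed vector, hence one zonal function, hence
  all of them by transitivity on the level, and these span. On level 0 the space is a line.\<close>

lemma invariant_in_V:
  assumes W: "invariant G \<rho> W" and WV: "W \<subseteq> V n" and ne: "W \<noteq> {0}"
  shows "W = V n"
proof (rule equalityI[OF WV])
  have sub: "fs.subspace W" using invariantD(1)[OF W] .
  obtain f where f: "f \<in> W" "f \<noteq> 0" using ne fs.subspace_0[OF sub] by blast
  obtain v \<psi> where v: "v \<in> level m n" "lift n \<psi> \<in> W" "fixed v (lift n \<psi>)" "\<psi> v \<noteq> 0"
    using invariant_contains_fixed[OF W f(1) _ f(2)] WV V_subset_U f(1) by blast
  show "V n \<subseteq> W"
  proof (cases n)
    case 0
    have "\<psi> [] \<noteq> 0" using v 0 by simp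
    then have "inverse (\<psi> []) * \<psi> [] = 1" by simp
    then have "fscale (inverse (\<psi> [])) (lift 0 \<psi>) = lift 0 (\<lambda>w. 1)"
      unfolding lift_0_eq[of \<psi>] fs.scale_scale by (simp only: fs.scale_one)
    then have one: "lift 0 (\<lambda>w. 1) \<in> W"
      using fs.subspace_scale[OF sub v(2)] unfolding 0 by metis
    show ?thesis unfolding 0 V_0 U_def
    proof (rule image_subsetI)
      fix \<phi> show "lift 0 \<phi> \<in> W"
        unfolding lift_0_eq[of \<phi>] by (rule fs.subspace_scale[OF sub one])
    qed
  next
    case (Suc k)
    obtain c where "lift n (zonal v) = fscale c (lift n \<psi>)"
      using fixed_in_V_zonal[of k \<psi> v] v WV unfolding Suc by blast
    then have z: "lift n (zonal v) \<in> W" using fs.subspace_scale[OF sub v(2)] by simp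
    have z': "lift n (zonal v') \<in> W" if v': "v' \<in> level m n" for v'
    proof -
      \<comment> \<open>The direction matters: translation by \<open>g\<close> substitutes
        \<open>g w\<close>, so it takes the zonal function at \<open>v\<close> to the one at the
        preimage \<open>v'\<close>.\<close>
      obtain g where g: "g \<in> H" "g v' = v"
        using transitive_level[of v' v] v v' by auto
      have "ract \<rho> g (lift n (zonal v)) = lift n (zonal v')"
        unfolding act_lift[OF g(1)] by (rule lift_cong) (rule zonal_act[OF g(1) v(1) v' g(2)])
      then show ?thesis using invariantD(3)[OF W g(1) z] by simp
    qed
    show ?thesis
    proof
      fix h assume h: "h \<in> V n"
      then obtain \<phi> where \<phi>: "h = lift n \<phi>" using V_subset_U by (auto simp: U_def)
      have "h = fscale (1 / of_nat (m n)) (\<Sum>v\<in>level m n. fscale (\<phi> v) (lift n (zonal v)))"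
        using zonal_expansion[of k \<phi>] h unfolding \<phi> Suc by blast
      also have "\<dots> \<in> W"
        using z' by (intro fs.subspace_scale[OF sub] fs.subspace_sum[OF sub]) blast
      finally show "h \<in> W" .
    qed
  qed
qed

lemma lift_one_nonzero: "lift n (\<lambda>w. 1) \<noteq> 0"
  unfolding lift_eq_0_iff using pref_base by force

lemma V_nonzero: "V n \<noteq> {0}"
proof (cases n)
  case 0
  then show ?thesis using lift_one_nonzero[of 0] U_lift V_0 by blast
next
  case (Suc k)
  let ?L = "level m (Suc k)"
  have p: "pref \<xi> k \<in> level m k" using pref_base by simp
  \<comment> \<open>Values 1 and -1 at two siblings; the letters 0 and 1 both occur because
    \<open>m (Suc k)\<close> is at least 2.\<close>
  let ?\<phi> = "\<lambda>w. if w = pref \<xi> k @ [0] then 1 else if w = pref \<xi> k @ [1] then - 1 else (0::complex)"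
  have "lift (Suc k) ?\<phi> \<in> V (Suc k)"
  proof (rule lift_in_V)
    fix q assume q: "q \<in> level m k"
    have "csum ?\<phi> q = (\<Sum>w\<in>children m q. (if w = pref \<xi> k @ [0] then 1 else 0)
       - (if w = pref \<xi> k @ [1] then 1 else 0))"
      unfolding csum_def by (rule sum.cong) auto
    also have "\<dots> = (if pref \<xi> k @ [0] \<in> children m q then 1 else 0) -
       (if pref \<xi> k @ [1] \<in> children m q then 1 else 0)"
      using finite_children[of q] q by (simp only: sum_subtractf sum.delta mem_Collect_eq)
    also have "\<dots> = 0"
      using branching[of "Suc k"] pref_base[of k] by (auto simp: children_def append_in_vertices_iff)
    finally show "csum ?\<phi> q = 0" .
  qed
  moreover have "lift (Suc k) ?\<phi> \<noteq> 0"
    unfolding lift_eq_0_iff using branching[of "Suc k"] pref_base[of k]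
    by (auto simp: append_in_vertices_iff intro!: exI[of _ "pref \<xi> k @ [0]"])
  ultimately show ?thesis unfolding Suc by blast
qed

section \<open>Classification of the irreducible subrepresentations\<close>

lemma irreducible_subrep_iff:
  "irreducible_subrep G \<rho> W \<longleftrightarrow>
     invariant G \<rho> W \<and> W \<noteq> {0} \<and> (\<forall>W'. invariant G \<rho> W' \<and> W' \<subseteq> W \<longrightarrow> W' = {0} \<or> W' = W)"
proof -
  have "invariant G (restrict_rep \<rho> W) W' \<longleftrightarrow> invariant G \<rho> W' \<and> W' \<subseteq> W" if "W \<subseteq> X" for W'
    using that unfolding invariant_def by auto
  moreover have "is_rep G (restrict_rep \<rho> W)" if "invariant G \<rho> W"
    using invariantD[OF that] by (rule is_rep_sub)
  ultimately show ?thesis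
    unfolding irreducible_subrep_def irreducible_rep_def using invariantD(2)[of W] by auto
qed

lemma irreducible_V: "irreducible_subrep G \<rho> (V n)"
proof (intro irreducible_subrep_iff[THEN iffD2] conjI allI impI invariant_V V_nonzero)
  fix W' assume "invariant G \<rho> W' \<and> W' \<subseteq> V n"
  then show "W' = {0} \<or> W' = V n" using invariant_in_V[of W' n] by metis
qed

lemma irreducible_subrep_cases:
  assumes irr: "irreducible_subrep G \<rho> W"
  obtains n where "W = V n"
proof -
  have W: "invariant G \<rho> W" "W \<noteq> {0}"
    and min: "\<And>W'. invariant G \<rho> W' \<Longrightarrow> W' \<subseteq> W \<Longrightarrow> W' = {0} \<or> W' = W"
    using irr unfolding irreducible_subrep_iff by blast+
  have sub: "fs.subspace W" using invariantD(1)[OF W(1)] .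
  \<comment> \<open>The intersection is invariant, so irreducibility of \<open>W\<close> leaves only
    the two extremes.\<close>
  have inter: "W \<inter> U n = {0} \<or> W \<subseteq> U n" for n
  proof -
    have "invariant G \<rho> (W \<inter> U n)"
      using invariantD[OF W(1)] invariantD[OF invariant_U[of n]]
      by (intro invariantI fs.subspace_inter) blast+
    from min[OF this] show ?thesis by blast
  qed
  obtain f where f: "f \<in> W" "f \<noteq> 0" using W(2) fs.subspace_0[OF sub] by blast
  then obtain n0 where "f \<in> U n0" using invariantD(2)[OF W(1)] X_eq_Union by blast
  then have "W \<subseteq> U n0" using inter[of n0] f by blast
  \<comment> \<open>The least such level: if it is \<open>Suc k\<close>, then \<open>W\<close> meets
    \<open>U k\<close> only in 0.\<close>
  then obtain n where n: "W \<subseteq> U n" "\<And>k. k < n \<Longrightarrow> \<not> W \<subseteq> U k"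
    using exists_least_iff[of "\<lambda>n. W \<subseteq> U n"] by blast
  have "W \<subseteq> V n"
  proof (cases n)
    case 0
    then show ?thesis using n by (simp add: V_0)
  next
    case (Suc k)
    have k: "W \<inter> U k = {0}" using inter[of k] n(2)[of k] Suc by simp
    show ?thesis
    proof
      fix h assume h: "h \<in> W"
      then obtain \<phi> where \<phi>: "h = lift (Suc k) \<phi>" using n(1) Suc by (auto simp: U_def)
      show "h \<in> V n" unfolding \<phi> Suc
      proof (rule lift_in_V)
        fix p assume p: "p \<in> level m k"
        then obtain I where I: "finite I" "I \<noteq> {}" "\<And>g. g \<in> I \<Longrightarrow> g \<in> H \<and> g p = p"
          "fixed p (lift (Suc k) (\<lambda>w. \<Sum>g\<in>I. \<phi> (g w)))"
          using stabiliser_average[of p "Suc k" \<phi>] by blast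
        let ?u = "lift (Suc k) (\<lambda>w. \<Sum>g\<in>I. \<phi> (g w))"
        have "?u \<in> W" using h I(3) unfolding \<phi> by (intro average_in_invariant[OF W(1)]) blast+
        moreover have "?u \<in> U k" using p by (intro fixed_below[OF U_lift _ _ I(4)]) auto
        ultimately have "?u = 0" using k by blast
        then have z: "(\<Sum>g\<in>I. \<phi> (g w)) = 0" if "w \<in> level m (Suc k)" for w
          using that unfolding lift_eq_0_iff by blast
        \<comment> \<open>Each \<open>g\<close> in \<open>I\<close> fixes \<open>p\<close> and so
          permutes its children. The child sum of the vanishing average is thus
          \<open>card I\<close> times the child sum of \<phi>.\<close>
        have "0 = csum (\<lambda>w. \<Sum>g\<in>I. \<phi> (g w)) p"
          using csum_cong[OF p z] by (simp add: csum_def)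
        also have "\<dots> = (\<Sum>g\<in>I. csum (\<lambda>w. \<phi> (g w)) p)"
          unfolding csum_def by (rule sum.swap)
        also have "\<dots> = (\<Sum>g\<in>I. csum \<phi> p)"
        proof (rule sum.cong[OF refl])
          fix g assume "g \<in> I"
          then show "csum (\<lambda>w. \<phi> (g w)) p = csum \<phi> p"
            using I(3)[of g] csum_act[of g p \<phi>] p by simp
        qed
        finally show "csum \<phi> p = 0" using I(1,2) by simp
      qed
    qed
  qed
  then show thesis using that invariant_in_V[OF W(1) _ W(2)] by blast
qed

end

subsection \<open>Dimensions, isomorphisms and the decomposition\<close>

lemma linear_between_add:
  "linear_between V W \<phi> \<Longrightarrow> u \<in> V \<Longrightarrow> v \<in> V \<Longrightarrow> \<phi> (u + v) = \<phi> u + \<phi> v"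
  unfolding linear_between_def by blast

lemma linear_between_scale:
  "linear_between V W \<phi> \<Longrightarrow> v \<in> V \<Longrightarrow> \<phi> (fscale c v) = fscale c (\<phi> v)"
  unfolding linear_between_def by blast

lemma linear_between_0:
  assumes "linear_between V W \<phi>" "fs.subspace V"
  shows "\<phi> 0 = 0"
proof -
  have "0 \<in> V" using assms(2) by (rule fs.subspace_0)
  then have "\<phi> (fscale 0 0) = fscale 0 (\<phi> 0)" by (rule linear_between_scale[OF assms(1)])
  then show ?thesis by (simp only: fs.scale_zero_left fs.scale_zero_right)
qed

text \<open>Linearity is assumed on \<open>V\<close> only, so each partial sum is checked to lie in
  \<open>V\<close>.\<close>

lemma linear_between_sum:
  assumes lin: "linear_between V W \<phi>" and V: "fs.subspace V" and "finite F" "F \<subseteq> V"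
  shows "\<phi> (\<Sum>b\<in>F. fscale (c b) b) = (\<Sum>b\<in>F. fscale (c b) (\<phi> b))"
  using \<open>finite F\<close> \<open>F \<subseteq> V\<close>
proof (induction F rule: finite_induct)
  case empty
  show ?case by (simp only: sum.empty linear_between_0[OF lin V])
next
  case (insert x F)
  have "(\<Sum>b\<in>F. fscale (c b) b) \<in> V"
    using insert.prems by (intro fs.subspace_sum[OF V] fs.subspace_scale[OF V]) blast
  moreover have x: "x \<in> V" using insert.prems by blast
  then have "fscale (c x) x \<in> V" by (rule fs.subspace_scale[OF V])
  ultimately have "\<phi> (fscale (c x) x + (\<Sum>b\<in>F. fscale (c b) b)) =
      fscale (c x) (\<phi> x) + (\<Sum>b\<in>F. fscale (c b) (\<phi> b))"
    using insert.IH insert.prems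
    by (simp only: linear_between_add[OF lin] linear_between_scale[OF lin x] insert_subset)
  then show ?case by (simp only: sum.insert[OF insert.hyps])
qed

text \<open>The image of a finite basis is a basis of the same size. This gives the dimension of an
  arbitrary representative of an isomorphism class.\<close>

lemma dim_eq_of_linear_bij:
  assumes lin: "linear_between V W \<phi>" and bij: "bij_betw \<phi> V W" and V: "fs.subspace V"
    and B: "finite B" "B \<subseteq> V" "fs.independent B" "V \<subseteq> fs.span B"
  shows "fs.dim W = fs.dim V"
proof -
  have inj: "inj_on \<phi> V" using bij by (simp add: bij_betw_def)
  then have injB: "inj_on \<phi> B" using B(2) by (rule inj_on_subset)
  have "fs.independent (\<phi> ` B)"
  proof (rule fs.independent_if_scalars_zero)
    show "finite (\<phi> ` B)" using B(1) by simp
    fix f x assume s: "(\<Sum>x\<in>\<phi> ` B. fscale (f x) x) = 0" and "x \<in> \<phi> ` B"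
    then obtain b where b: "b \<in> B" "x = \<phi> b" by blast
    have "\<phi> (\<Sum>b\<in>B. fscale (f (\<phi> b)) b) = \<phi> 0"
      using s unfolding sum.reindex[OF injB] o_def linear_between_sum[OF lin V B(1,2)]
        linear_between_0[OF lin V] .
    moreover have "(\<Sum>b\<in>B. fscale (f (\<phi> b)) b) \<in> V"
      using B(2) by (intro fs.subspace_sum[OF V] fs.subspace_scale[OF V]) blast
    ultimately have "(\<Sum>b\<in>B. fscale (f (\<phi> b)) b) = 0"
      using inj_onD[OF inj] fs.subspace_0[OF V] by blast
    then show "f x = 0"
      using fs.independentD[OF B(3,1) subset_refl _ b(1), of "\<lambda>b. f (\<phi> b)"] b(2) by simp
  qed
  moreover have "\<phi> ` B \<subseteq> W" using B(2) bij by (auto simp: bij_betw_def)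
  moreover have "W \<subseteq> fs.span (\<phi> ` B)"
  proof
    fix w assume "w \<in> W"
    then obtain v where v: "v \<in> V" "w = \<phi> v" using bij by (auto simp: bij_betw_def)
    then obtain u where "v = (\<Sum>b\<in>B. fscale (u b) b)"
      using B(4) fs.span_finite[OF B(1)] by blast
    then have "w = (\<Sum>b\<in>B. fscale (u b) (\<phi> b))"
      using v(2) linear_between_sum[OF lin V B(1,2)] by simp
    also have "\<dots> \<in> fs.span (\<phi> ` B)"
      by (intro fs.span_sum fs.span_scale fs.span_base imageI)
    finally show "w \<in> fs.span (\<phi> ` B)" .
  qed
  ultimately have "fs.dim W = card (\<phi> ` B)" by (intro fs.dim_unique) auto
  moreover have "fs.dim V = card B" using B by (intro fs.dim_unique) auto
  ultimately show ?thesis using injB by (simp add: card_image)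
qed

lemma iso_rep_refl: "iso_rep G \<rho> \<rho>"
  unfolding iso_rep_def by (rule exI[of _ "\<lambda>v. v"]) (auto simp: linear_between_def bij_betw_def)

lemma iso_rep_trans:
  assumes "iso_rep G \<rho> \<sigma>" "iso_rep G \<sigma> \<tau>"
  shows "iso_rep G \<rho> \<tau>"
proof -
  obtain \<phi> where \<phi>: "linear_between (rspace \<rho>) (rspace \<sigma>) \<phi>" "bij_betw \<phi> (rspace \<rho>) (rspace \<sigma>)"
    "\<forall>g\<in>carrier G. \<forall>v\<in>rspace \<rho>. \<phi> (ract \<rho> g v) = ract \<sigma> g (\<phi> v)"
    using assms(1) unfolding iso_rep_def by blast
  obtain \<psi> where \<psi>: "linear_between (rspace \<sigma>) (rspace \<tau>) \<psi>" "bij_betw \<psi> (rspace \<sigma>) (rspace \<tau>)"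
    "\<forall>g\<in>carrier G. \<forall>v\<in>rspace \<sigma>. \<psi> (ract \<sigma> g v) = ract \<tau> g (\<psi> v)"
    using assms(2) unfolding iso_rep_def by blast
  have m: "\<phi> v \<in> rspace \<sigma>" if "v \<in> rspace \<rho>" for v
    using \<phi>(1) that unfolding linear_between_def by blast
  have "linear_between (rspace \<rho>) (rspace \<tau>) (\<psi> \<circ> \<phi>)"
    using \<phi>(1) \<psi>(1) m unfolding linear_between_def by (simp add: image_subset_iff)
  moreover have "bij_betw (\<psi> \<circ> \<phi>) (rspace \<rho>) (rspace \<tau>)" using \<phi>(2) \<psi>(2) by (rule bij_betw_trans)
  moreover have "(\<psi> \<circ> \<phi>) (ract \<rho> g v) = ract \<tau> g ((\<psi> \<circ> \<phi>) v)"
    if "g \<in> carrier G" "v \<in> rspace \<rho>" for g v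
    using \<phi>(3) \<psi>(3) m that by simp
  ultimately show ?thesis unfolding iso_rep_def by blast
qed

text \<open>Since \<open>rspace \<rho>\<close> is closed under the operations and the action, the
  natural candidates for the values of the inverse lie in it, and injectivity identifies
  them.\<close>

lemma iso_rep_sym:
  assumes \<rho>: "is_rep G \<rho>" and iso: "iso_rep G \<rho> \<sigma>"
  shows "iso_rep G \<sigma> \<rho>"
proof -
  obtain \<phi> where \<phi>: "linear_between (rspace \<rho>) (rspace \<sigma>) \<phi>" "bij_betw \<phi> (rspace \<rho>) (rspace \<sigma>)"
    "\<forall>g\<in>carrier G. \<forall>v\<in>rspace \<rho>. \<phi> (ract \<rho> g v) = ract \<sigma> g (\<phi> v)"
    using iso unfolding iso_rep_def by blast
  let ?i = "inv_into (rspace \<rho>) \<phi>"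
  have sub: "fs.subspace (rspace \<rho>)" using \<rho> unfolding is_rep_def by blast
  have inj: "inj_on \<phi> (rspace \<rho>)" using \<phi>(2) by (simp add: bij_betw_def)
  have i: "?i w \<in> rspace \<rho>" "\<phi> (?i w) = w" if "w \<in> rspace \<sigma>" for w
    using that \<phi>(2) by (auto simp: bij_betw_def inv_into_into f_inv_into_f)
  have eqI: "?i w = v" if "v \<in> rspace \<rho>" "\<phi> v = w" for v w
    using that inj by (auto simp: inv_into_f_eq)
  have add: "\<phi> (u + v) = \<phi> u + \<phi> v" if "u \<in> rspace \<rho>" "v \<in> rspace \<rho>" for u v
    using \<phi>(1) that unfolding linear_between_def by blast
  have scale: "\<phi> (fscale c v) = fscale c (\<phi> v)" if "v \<in> rspace \<rho>" for c v
    using \<phi>(1) that unfolding linear_between_def by blast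
  have "linear_between (rspace \<sigma>) (rspace \<rho>) ?i"
    unfolding linear_between_def
  proof (intro conjI ballI allI image_subsetI)
    fix u v c assume u: "u \<in> rspace \<sigma>"
    then show "?i u \<in> rspace \<rho>" by (rule i)
    show "?i (fscale c u) = fscale c (?i u)"
      using i[OF u] by (intro eqI) (simp_all only: scale fs.subspace_scale[OF sub])
    assume v: "v \<in> rspace \<sigma>"
    show "?i (u + v) = ?i u + ?i v"
      using i[OF u] i[OF v] by (intro eqI) (simp_all only: add fs.subspace_add[OF sub])
  qed
  moreover have "bij_betw ?i (rspace \<sigma>) (rspace \<rho>)" using \<phi>(2) by (rule bij_betw_inv_into)
  moreover have "?i (ract \<sigma> g w) = ract \<rho> g (?i w)" if "g \<in> carrier G" "w \<in> rspace \<sigma>" for g w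
  proof (rule eqI)
    show "ract \<rho> g (?i w) \<in> rspace \<rho>"
      using \<rho> i(1)[OF that(2)] that(1) unfolding is_rep_def linear_between_def by blast
    show "\<phi> (ract \<rho> g (?i w)) = ract \<sigma> g w"
      using \<phi>(3) i[OF that(2)] that(1) by simp
  qed
  ultimately show ?thesis unfolding iso_rep_def by blast
qed

lemma direct_sum_obtain:
  assumes "direct_sum I U X" "x \<in> X"
  obtains F u where "x = (\<Sum>i\<in>F. u i)" "finite F" "F \<subseteq> I" "\<forall>i\<in>F. u i \<in> U i"
proof -
  have "X = {\<Sum>i\<in>F. u i | F u. finite F \<and> F \<subseteq> I \<and> (\<forall>i\<in>F. u i \<in> U i)}"
    using assms(1) unfolding direct_sum_def by (rule conjunct1)
  then have "x \<in> {\<Sum>i\<in>F. u i | F u. finite F \<and> F \<subseteq> I \<and> (\<forall>i\<in>F. u i \<in> U i)}"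
    using assms(2) by (rule subst)
  then show thesis using that by (elim CollectE exE conjE)
qed

lemma direct_sum_independent:
  assumes "direct_sum I U X" "finite F" "F \<subseteq> I" "\<forall>i\<in>F. u i \<in> U i" "(\<Sum>i\<in>F. u i) = 0" "i \<in> F"
  shows "u i = 0"
proof -
  have "\<forall>F u. finite F \<and> F \<subseteq> I \<and> (\<forall>i\<in>F. u i \<in> U i) \<and> (\<Sum>i\<in>F. u i) = 0 \<longrightarrow> (\<forall>i\<in>F. u i = 0)"
    using assms(1) unfolding direct_sum_def by (rule conjunct2)
  from this[rule_format, of F u i] show ?thesis using assms(2-) by blast
qed

text \<open>Passes between the family indexed by levels and the set of subspaces that
  \<open>irreducible_decomposition\<close> speaks of. Finite sums correspond along \<open>U\<close>,
  and injectivity keeps distinct indices from merging.\<close>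

lemma direct_sum_reindex:
  assumes inj: "inj_on U I"
  shows "direct_sum (U ` I) (\<lambda>W. W) X \<longleftrightarrow> direct_sum I U X"
proof -
  define A where "A F u \<longleftrightarrow> finite F \<and> F \<subseteq> U ` I \<and> (\<forall>W\<in>F. u W \<in> W)" for F u
  define B where "B F u \<longleftrightarrow> finite F \<and> F \<subseteq> I \<and> (\<forall>i\<in>F. u i \<in> U i)" for F u
  have fwd: "\<exists>F' u'. B F' u' \<and> sum u' F' = sum u F \<and> ((\<forall>i\<in>F'. u' i = 0) \<longleftrightarrow> (\<forall>W\<in>F. u W = 0))"
    if "A F u" for F u
  proof -
    have F: "finite F" "F \<subseteq> U ` I" "\<forall>W\<in>F. u W \<in> W" using that by (simp_all add: A_def)
    obtain F' where F': "F' \<subseteq> I" "inj_on U F'" "F = U ` F'"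
      using F(2) subset_image_inj[of F U I] by blast
    have "finite F'" using F(1) F'(2,3) finite_imageD by blast
    then have "B F' (u \<circ> U)" using F(3) F'(1,3) by (simp add: B_def)
    moreover have "sum (u \<circ> U) F' = sum u F" unfolding F'(3) sum.reindex[OF F'(2)] ..
    moreover have "(\<forall>i\<in>F'. (u \<circ> U) i = 0) \<longleftrightarrow> (\<forall>W\<in>F. u W = 0)" using F'(3) by simp
    ultimately show ?thesis by blast
  qed
  have bwd: "\<exists>F' u'. A F' u' \<and> sum u' F' = sum u F \<and> ((\<forall>W\<in>F'. u' W = 0) \<longleftrightarrow> (\<forall>i\<in>F. u i = 0))"
    if "B F u" for F u
  proof -
    have F: "finite F" "F \<subseteq> I" "\<forall>i\<in>F. u i \<in> U i" using that by (simp_all add: B_def)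
    have injF: "inj_on U F" using inj F(2) by (rule inj_on_subset)
    let ?u = "\<lambda>W. u (inv_into F U W)"
    have u: "?u (U i) = u i" if "i \<in> F" for i using injF that by simp
    have "A (U ` F) ?u" using F u by (auto simp: A_def)
    moreover have "sum ?u (U ` F) = sum u F"
      unfolding sum.reindex[OF injF] o_def by (rule sum.cong) (simp_all add: u)
    moreover have "(\<forall>W\<in>U ` F. ?u W = 0) \<longleftrightarrow> (\<forall>i\<in>F. u i = 0)" using u by simp
    ultimately show ?thesis by blast
  qed
  have "direct_sum (U ` I) (\<lambda>W. W) X \<longleftrightarrow>
      X = {f. \<exists>F u. f = sum u F \<and> A F u} \<and> (\<forall>F u. A F u \<and> sum u F = 0 \<longrightarrow> (\<forall>W\<in>F. u W = 0))"
    unfolding direct_sum_def A_def by (simp only: conj_assoc)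
  also have "{f. \<exists>F u. f = sum u F \<and> A F u} = {f. \<exists>F u. f = sum u F \<and> B F u}"
    using fwd bwd by (intro Collect_cong iffI; metis)
  also have "(\<forall>F u. A F u \<and> sum u F = 0 \<longrightarrow> (\<forall>W\<in>F. u W = 0)) \<longleftrightarrow>
      (\<forall>F u. B F u \<and> sum u F = 0 \<longrightarrow> (\<forall>i\<in>F. u i = 0))" (is "?L \<longleftrightarrow> ?R")
  proof
    assume L: ?L
    show ?R
    proof (intro allI impI)
      fix F u assume u: "B F u \<and> sum u F = 0"
      obtain F' u' where u': "A F' u'" "sum u' F' = sum u F" "(\<forall>W\<in>F'. u' W = 0) \<longleftrightarrow> (\<forall>i\<in>F. u i = 0)"
        using bwd[OF conjunct1[OF u]] by (elim exE conjE)
      have "A F' u' \<and> sum u' F' = 0" using u u'(1,2) by metis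
      then show "\<forall>i\<in>F. u i = 0" using L u'(3) by metis
    qed
  next
    assume R: ?R
    show ?L
    proof (intro allI impI)
      fix F u assume u: "A F u \<and> sum u F = 0"
      obtain F' u' where u': "B F' u'" "sum u' F' = sum u F" "(\<forall>i\<in>F'. u' i = 0) \<longleftrightarrow> (\<forall>W\<in>F. u W = 0)"
        using fwd[OF conjunct1[OF u]] by (elim exE conjE)
      have "B F' u' \<and> sum u' F' = 0" using u u'(1,2) by metis
      then show "\<forall>W\<in>F. u W = 0" using R u'(3) by metis
    qed
  qed
  also have "X = {f. \<exists>F u. f = sum u F \<and> B F u} \<and> (\<forall>F u. B F u \<and> sum u F = 0 \<longrightarrow> (\<forall>i\<in>F. u i = 0)) \<longleftrightarrow>
      direct_sum I U X"
    unfolding direct_sum_def B_def by (simp only: conj_assoc)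
  finally show ?thesis .
qed

section \<open>Bases and dimensions of the constituents\<close>

context boundary_transitive
begin

lemma card_level: "card (level m n) = (\<Prod>j=1..n. m j)"
proof (induction n)
  case 0
  have "level m 0 = {[]}" by (auto simp: vertices_def)
  then show ?case by simp
next
  case (Suc n)
  have "card (level m (Suc n)) = card (level m n \<times> {..<m (Suc n)})"
    unfolding level_Suc_eq by (rule card_image) (auto simp: inj_on_def)
  then show ?case using Suc by (simp add: card_cartesian_product)
qed

lemma csum_eq_sum: "p \<in> level m n \<Longrightarrow> csum \<phi> p = (\<Sum>i<m (Suc n). \<phi> (p @ [i]))"
  by (simp add: csum_def children_eq_image sum.reindex[OF inj_append_single])

text \<open>Basis vectors are indexed by a parent \<open>q\<close> and a nonzero letter
  \<open>i\<close>: value 1 at \<open>q @ [i]\<close> and -1 at \<open>q @ [0]\<close>. Vanishing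
  child sums recover the value at the child with letter 0 from those at its siblings.\<close>

lemma V_Suc_basis:
  obtains B where "finite B" "B \<subseteq> V (Suc n)" "fs.independent B" "V (Suc n) \<subseteq> fs.span B"
    "card B = (m (Suc n) - 1) * (\<Prod>j=1..n. m j)"
proof -
  let ?K = "level m n \<times> {1..<m (Suc n)}"
  let ?d = "\<lambda>k w. (if w = fst k @ [snd k] then 1 else 0) - (if w = fst k @ [0] then 1 else (0::complex))"
  let ?b = "\<lambda>k. lift (Suc n) (?d k)"
  have finK: "finite ?K" by (simp add: finite_level)
  have m0: "0 < m (Suc n)" using branching[of "Suc n"] by simp
  have pos: "q @ [i] \<in> level m (Suc n)" if "q \<in> level m n" "i < m (Suc n)" for q i
    using that by (auto simp: append_in_vertices_iff)
  have posK: "fst k @ [snd k] \<in> level m (Suc n)" if "k \<in> ?K" for k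
    using that by (intro pos) (auto simp: mem_Times_iff)
  \<comment> \<open>Evaluation at a vertex with nonzero last letter reads off one coefficient; this
    gives independence and most of the spanning property.\<close>
  have top: "(\<Sum>k\<in>?K. c k * ?d k (fst k0 @ [snd k0])) = c k0" if k0: "k0 \<in> ?K" for c k0
  proof -
    have "(\<Sum>k\<in>?K. c k * ?d k (fst k0 @ [snd k0])) = (\<Sum>k\<in>?K. if k = k0 then c k0 else 0)"
    proof (rule sum.cong[OF refl])
      fix k assume "k \<in> ?K"
      have "fst k0 @ [snd k0] = fst k @ [snd k] \<longleftrightarrow> k = k0" by (auto simp: prod_eq_iff)
      moreover have "snd k0 \<noteq> 0" using k0 by (simp add: mem_Times_iff)
      ultimately show "c k * ?d k (fst k0 @ [snd k0]) = (if k = k0 then c k0 else 0)" by simp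
    qed
    then show ?thesis using k0 finK by (simp add: sum.delta)
  qed
  have lift_K: "(\<Sum>k\<in>?K. fscale (c k) (?b k)) = lift (Suc n) (\<lambda>w. \<Sum>k\<in>?K. c k * ?d k w)" for c
    by (simp only: lift_sum lift_scale)
  have inj: "inj_on ?b ?K"
  proof (rule inj_onI)
    fix k k' assume k: "k \<in> ?K" "k' \<in> ?K" and eq: "?b k = ?b k'"
    have "\<forall>w\<in>level m (Suc n). ?d k w = ?d k' w" using eq unfolding lift_eq_iff .
    from bspec[OF this posK[OF k(1)]] have "?d k (fst k @ [snd k]) = ?d k' (fst k @ [snd k])" .
    moreover have "snd k \<noteq> 0" using k by (simp add: mem_Times_iff)
    ultimately have "fst k @ [snd k] = fst k' @ [snd k']" by (simp split: if_splits)
    then show "k = k'" by (simp add: prod_eq_iff)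
  qed
  let ?B = "?b ` ?K"
  have "?B \<subseteq> V (Suc n)"
  proof (rule image_subsetI, rule lift_in_V)
    fix k p assume k: "k \<in> ?K" and p: "p \<in> level m n"
    have "csum (?d k) p = (\<Sum>i<m (Suc n). (if i = snd k then if p = fst k then 1 else 0 else 0)
       - (if i = 0 then if p = fst k then 1 else 0 else 0))"
      unfolding csum_eq_sum[OF p] by (rule sum.cong) auto
    also have "\<dots> = 0" using k m0 by (auto simp: sum_subtractf sum.delta)
    finally show "csum (?d k) p = 0" .
  qed
  moreover have "fs.independent ?B"
  proof (rule fs.independent_if_scalars_zero)
    show "finite ?B" using finK by simp
    fix f x assume s: "(\<Sum>x\<in>?B. fscale (f x) x) = 0" and "x \<in> ?B"
    then obtain k0 where k0: "k0 \<in> ?K" "x = ?b k0" by blast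
    have "lift (Suc n) (\<lambda>w. \<Sum>k\<in>?K. f (?b k) * ?d k w) = 0"
      using s unfolding sum.reindex[OF inj] o_def lift_K .
    then have "\<forall>w\<in>level m (Suc n). (\<Sum>k\<in>?K. f (?b k) * ?d k w) = 0" unfolding lift_eq_0_iff .
    from bspec[OF this posK[OF k0(1)]]
    have "(\<Sum>k\<in>?K. f (?b k) * ?d k (fst k0 @ [snd k0])) = 0" .
    then show "f x = 0" using top[OF k0(1), of "\<lambda>k. f (?b k)"] k0(2) by simp
  qed
  moreover have "V (Suc n) \<subseteq> fs.span ?B"
  proof
    fix h assume h: "h \<in> V (Suc n)"
    then obtain \<phi> where \<phi>: "h = lift (Suc n) \<phi>" "\<forall>p\<in>level m n. csum \<phi> p = 0" by (rule V_SucE)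
    let ?c = "\<lambda>k. \<phi> (fst k @ [snd k])"
    have "h = lift (Suc n) (\<lambda>w. \<Sum>k\<in>?K. ?c k * ?d k w)"
      unfolding \<phi>(1)
    proof (rule lift_cong)
      fix w assume "w \<in> level m (Suc n)"
      then obtain q j where w: "w = q @ [j]" "q \<in> level m n" "j < m (Suc n)"
        unfolding level_Suc_eq by auto
      show "\<phi> w = (\<Sum>k\<in>?K. ?c k * ?d k w)"
      proof (cases "j = 0")
        case False
        then show ?thesis using top[of "(q, j)" ?c] w by simp
      next
        case True
        \<comment> \<open>At the child with letter 0 every basis vector over the parent
          \<open>q\<close> contributes -1 times its coefficient, in total
          \<open>\<phi> (q @ [0])\<close> minus the child sum at \<open>q\<close>, which is
          0.\<close>
        have "(\<Sum>k\<in>?K. ?c k * ?d k w) = (\<Sum>k\<in>?K. if k \<in> {q} \<times> {1..<m (Suc n)} then - ?c k else 0)"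
        proof (rule sum.cong[OF refl])
          fix k assume k: "k \<in> ?K"
          then have "snd k \<noteq> 0" "k \<in> {q} \<times> {1..<m (Suc n)} \<longleftrightarrow> q = fst k"
            by (auto simp: mem_Times_iff)
          then show "?c k * ?d k w = (if k \<in> {q} \<times> {1..<m (Suc n)} then - ?c k else 0)"
            unfolding w(1) True by simp
        qed
        also have "\<dots> = (\<Sum>k\<in>?K \<inter> {q} \<times> {1..<m (Suc n)}. - ?c k)"
          by (rule sum.inter_restrict[symmetric, OF finK])
        also have "?K \<inter> {q} \<times> {1..<m (Suc n)} = {q} \<times> {1..<m (Suc n)}"
          by (rule Int_absorb1, rule Sigma_mono) (use w(2) in simp_all)
        also have "(\<Sum>k\<in>{q} \<times> {1..<m (Suc n)}. - ?c k) = (\<Sum>i\<in>{1..<m (Suc n)}. - \<phi> (q @ [i]))"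
          by (rule sum.reindex_bij_witness[of _ "\<lambda>i. (q, i)" snd]) auto
        also have "\<dots> = \<phi> (q @ [0]) - csum \<phi> q"
          unfolding csum_eq_sum[OF w(2)] lessThan_atLeast0 sum.atLeast_Suc_lessThan[OF m0]
          by (simp add: sum_negf)
        finally show ?thesis using \<phi>(2) w True by simp
      qed
    qed
    also have "\<dots> \<in> fs.span ?B"
      unfolding lift_K[symmetric] by (intro fs.span_sum fs.span_scale fs.span_base imageI)
    finally show "h \<in> fs.span ?B" .
  qed
  moreover have "card ?B = (m (Suc n) - 1) * (\<Prod>j=1..n. m j)"
    unfolding card_image[OF inj] card_cartesian_product card_level by simp
  ultimately show thesis using that[of ?B] finK by blast
qed

lemma V_0_basis:
  "fs.independent {lift 0 (\<lambda>w. 1)}" "{lift 0 (\<lambda>w. 1)} \<subseteq> V 0" "V 0 \<subseteq> fs.span {lift 0 (\<lambda>w. 1)}"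
proof -
  show "fs.independent {lift 0 (\<lambda>w. 1)}" using lift_one_nonzero by simp
  show "{lift 0 (\<lambda>w. 1)} \<subseteq> V 0" by (simp add: V_0 U_lift)
  show "V 0 \<subseteq> fs.span {lift 0 (\<lambda>w. 1)}"
  proof
    fix h assume "h \<in> V 0"
    then obtain \<phi> where "h = lift 0 \<phi>" by (auto simp: V_0 U_def)
    then show "h \<in> fs.span {lift 0 (\<lambda>w. 1)}"
      using lift_0_eq[of \<phi>] by (metis fs.span_base fs.span_scale singletonI)
  qed
qed

lemma dim_V_0: "fs.dim (V 0) = 1"
  using V_0_basis by (intro fs.dim_unique) auto

lemma dim_V_Suc: "fs.dim (V (Suc n)) = (m (Suc n) - 1) * (\<Prod>j=1..n. m j)"
  by (rule V_Suc_basis[of n]) (auto intro: fs.dim_unique)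

lemma V_finite_basis:
  obtains B where "finite B" "B \<subseteq> V n" "fs.independent B" "V n \<subseteq> fs.span B"
proof (cases n)
  case 0
  then show thesis using that[of "{lift 0 (\<lambda>w. 1)}"] V_0_basis by simp
next
  case (Suc k)
  then show thesis using V_Suc_basis[of k] that by metis
qed

lemma is_rep_V: "is_rep G (restrict_rep \<rho> (V n))"
  by (rule is_rep_sub[OF invariantD[OF invariant_V]])

lemma trivial_V_0: "trivial_rep G (restrict_rep \<rho> (V 0))"
  unfolding trivial_rep_def
proof (intro conjI ballI)
  fix g v assume "g \<in> carrier G" "v \<in> rspace (restrict_rep \<rho> (V 0))"
  then have g: "g \<in> H" and "v \<in> U 0" by (simp_all add: V_0)
  then obtain \<phi> where "v = lift 0 \<phi>" by (auto simp: U_def)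
  then have "ract \<rho> g v = v" unfolding \<open>v = lift 0 \<phi>\<close> act_lift[OF g]
    using H_length[OF g, of "[]"] by (intro lift_cong) (simp add: vertices_def)
  then show "ract (restrict_rep \<rho> (V 0)) g v = v" by simp
qed (use is_rep_V dim_V_0 in auto)

text \<open>A vector of \<open>V a\<close> fixed by the stabiliser of a vertex of level \<open>a\<close> maps to a vector of \<open>V b\<close>
  fixed by the same group, which factors through a level below \<open>b\<close> and so vanishes.\<close>

lemma not_iso_V_less:
  assumes "a < b" shows "\<not> iso_rep G (restrict_rep \<rho> (V a)) (restrict_rep \<rho> (V b))"
proof
  assume "iso_rep G (restrict_rep \<rho> (V a)) (restrict_rep \<rho> (V b))"
  then obtain \<phi> where \<phi>: "linear_between (V a) (V b) \<phi>" "bij_betw \<phi> (V a) (V b)"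
    "\<And>g v. g \<in> H \<Longrightarrow> v \<in> V a \<Longrightarrow> \<phi> (ract \<rho> g v) = ract \<rho> g (\<phi> v)"
    unfolding iso_rep_def by auto
  obtain k where b: "b = Suc k" "a \<le> k" using assms by (cases b) auto
  obtain f where f: "f \<in> V a" "f \<noteq> 0" using V_nonzero fs.subspace_0[OF subspace_V] by blast
  obtain v \<psi> where v: "v \<in> level m a" "lift a \<psi> \<in> V a" "fixed v (lift a \<psi>)" "\<psi> v \<noteq> 0"
    using invariant_contains_fixed[OF invariant_V f(1) _ f(2)] V_subset_U f(1) by blast
  let ?u = "lift a \<psi>"
  have "\<phi> ?u \<in> V b" using \<phi>(2) v(2) by (auto simp: bij_betw_def)
  moreover have "fixed v (\<phi> ?u)"
    using v(3) \<phi>(3)[OF _ v(2)] unfolding fixed_def by metis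
  ultimately have fx: "\<phi> ?u \<in> U (Suc k)" "fixed v (\<phi> ?u)"
    using V_subset_U[of b] b(1) by auto
  have "\<phi> ?u \<in> U k"
    by (rule fixed_below[OF fx(1) _ _ fx(2)]) (use v(1) b(2) in auto)
  then have "\<phi> ?u = 0" using V_Suc_Int_U[of "\<phi> ?u" k] \<open>\<phi> ?u \<in> V b\<close> b by simp
  then have "\<phi> ?u = \<phi> 0" using linear_between_0[OF \<phi>(1) subspace_V] by simp
  then have "?u = 0"
    using \<phi>(2) v(2) fs.subspace_0[OF subspace_V] unfolding bij_betw_def by (metis inj_onD)
  then show False using v(1,4) unfolding lift_eq_0_iff by blast
qed

lemma iso_V_imp_eq:
  assumes "iso_rep G (restrict_rep \<rho> (V a)) (restrict_rep \<rho> (V b))"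
  shows "a = b"
  using not_iso_V_less[of a b] not_iso_V_less[of b a] assms iso_rep_sym[OF is_rep_V assms]
  by (metis linorder_neqE_nat)

lemma inj_V: "inj V"
  using iso_V_imp_eq iso_rep_refl by (metis injI)

section \<open>The decomposition and its uniqueness\<close>

lemma U_eq_sum_V: "f \<in> U n \<Longrightarrow> \<exists>u. (\<forall>i. u i \<in> V i) \<and> f = (\<Sum>i\<le>n. u i)"
proof (induction n arbitrary: f)
  case 0
  then show ?case
    using fs.subspace_0[OF subspace_V] by (intro exI[of _ "\<lambda>i. if i = 0 then f else 0"]) (simp add: V_0)
next
  case (Suc n)
  obtain g where g: "g \<in> U n" "f - g \<in> V (Suc n)" using U_Suc_split[OF Suc.prems] .
  obtain u where u: "\<forall>i. u i \<in> V i" "g = (\<Sum>i\<le>n. u i)" using Suc.IH[OF g(1)] by blast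
  let ?u = "u(Suc n := f - g)"
  have "(\<Sum>i\<le>Suc n. ?u i) = (\<Sum>i\<le>n. u i) + (f - g)"
    unfolding sum.atMost_Suc by (intro arg_cong2[where f = "(+)"] sum.cong) auto
  also have "\<dots> = f" unfolding u(2)[symmetric] by simp
  finally have "f = (\<Sum>i\<le>Suc n. ?u i)" by (rule sym)
  moreover have "\<forall>i. ?u i \<in> V i" using u(1) g(2) by simp
  ultimately show ?case by blast
qed

text \<open>The top summand is minus the sum of the others, hence lies in \<open>U n\<close> and
  vanishes by \<open>V_Suc_Int_U\<close>; the rest follows by induction.\<close>

lemma sum_V_eq_0:
  assumes "\<forall>i\<le>n. u i \<in> V i" "(\<Sum>i\<le>n. u i) = 0" "i \<le> n"
  shows "u i = 0"
  using assms
proof (induction n)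
  case (Suc n)
  have s: "(\<Sum>i\<le>n. u i) \<in> U n"
  proof (rule fs.subspace_sum[OF subspace_U])
    fix i assume "i \<in> {..n}"
    then have "u i \<in> V i" "i \<le> n" using Suc.prems(1) by simp_all
    then show "u i \<in> U n" using V_subset_U U_mono by blast
  qed
  have "(\<Sum>i\<le>n. u i) + u (Suc n) = 0" using Suc.prems(2) unfolding sum.atMost_Suc .
  then have e: "u (Suc n) = - (\<Sum>i\<le>n. u i)" by (simp only: eq_neg_iff_add_eq_0 add.commute)
  then have "u (Suc n) \<in> U n" using fs.subspace_neg[OF subspace_U s] by simp
  then have z: "u (Suc n) = 0" using Suc.prems(1) by (intro V_Suc_Int_U) auto
  then have "(\<Sum>i\<le>n. u i) = 0" using e by (simp only: neg_equal_0_iff_equal)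
  then show ?case using Suc.IH Suc.prems(1,3) z by (cases "i = Suc n") auto
qed auto

lemma direct_sum_V: "direct_sum UNIV V X"
  unfolding direct_sum_def
proof (intro conjI allI impI)
  show "X = {\<Sum>i\<in>F. u i |F u. finite F \<and> F \<subseteq> UNIV \<and> (\<forall>i\<in>F. u i \<in> V i)}"
  proof (intro equalityI subsetI)
    fix f assume "f \<in> X"
    then obtain n where "f \<in> U n" unfolding X_eq_Union by blast
    then obtain u where "\<forall>i. u i \<in> V i" "f = (\<Sum>i\<le>n. u i)" using U_eq_sum_V by blast
    then show "f \<in> {\<Sum>i\<in>F. u i |F u. finite F \<and> F \<subseteq> UNIV \<and> (\<forall>i\<in>F. u i \<in> V i)}"
      by (intro CollectI exI[of _ "{..n}"] exI[of _ u]) simp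
  next
    fix f assume "f \<in> {\<Sum>i\<in>F. u i |F u. finite F \<and> F \<subseteq> UNIV \<and> (\<forall>i\<in>F. u i \<in> V i)}"
    then obtain F u where f: "f = (\<Sum>i\<in>F. u i)" "\<forall>i\<in>F. u i \<in> V i" by blast
    then show "f \<in> X" unfolding f(1) using V_subset_X by (intro fs.subspace_sum[OF subspace_X]) blast
  qed
next
  fix F u assume F: "finite F \<and> F \<subseteq> UNIV \<and> (\<forall>i\<in>F. u i \<in> V i) \<and> (\<Sum>i\<in>F. u i) = 0"
  have "finite F" using F by (rule conjunct1)
  then obtain n where n: "F \<subseteq> {..n}" using finite_nat_iff_bounded_le by blast
  \<comment> \<open>Padding with zeros turns the finite index set into an initial segment.\<close>
  let ?u = "\<lambda>i. if i \<in> F then u i else 0"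
  have "(\<Sum>i\<le>n. ?u i) = (\<Sum>i\<in>{..n} \<inter> F. u i)" by (rule sum.inter_restrict[symmetric]) simp
  also have "{..n} \<inter> F = F" using n by blast
  finally have "(\<Sum>i\<le>n. ?u i) = 0" using F by (elim conjE) (rule trans)
  moreover have "\<forall>i\<le>n. ?u i \<in> V i" using F fs.subspace_0[OF subspace_V] by simp
  ultimately have "?u i = 0" if "i \<le> n" for i using sum_V_eq_0[of n ?u i] that by blast
  then show "\<forall>i\<in>F. u i = 0" using n by (metis atMost_iff subsetD)
qed

lemma decomposition_V: "irreducible_decomposition G \<rho> (range V)"
  unfolding irreducible_decomposition_def direct_sum_reindex[OF inj_V]
  using irreducible_V direct_sum_V by blast

text \<open>Every summand is some \<open>V n\<close>. If \<open>V k\<close> were missing, a nonzero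
  vector of it would be a sum of vectors from other constituents, against directness. Uniqueness
  makes the description in \<open>multiplicity_rep\<close> computable.\<close>

lemma decomposition_unique:
  assumes D: "irreducible_decomposition G \<rho> D"
  shows "D = range V"
proof
  show sub: "D \<subseteq> range V"
  proof
    fix W assume "W \<in> D"
    then have "irreducible_subrep G \<rho> W" using D unfolding irreducible_decomposition_def by blast
    then show "W \<in> range V" using irreducible_subrep_cases by blast
  qed
  show "range V \<subseteq> D"
  proof (rule image_subsetI, rule ccontr)
    fix k assume k: "V k \<notin> D"
    obtain x where x: "x \<in> V k" "x \<noteq> 0" using V_nonzero fs.subspace_0[OF subspace_V] by blast
    have "x \<in> X" using x(1) V_subset_X by blast
    then obtain F u where F: "x = (\<Sum>W\<in>F. u W)" "finite F" "F \<subseteq> D" "\<forall>W\<in>F. u W \<in> W"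
      using D direct_sum_obtain[of D "\<lambda>W. W" X x] unfolding irreducible_decomposition_def by metis
    \<comment> \<open>Moves \<open>x\<close> to the other side: a vanishing sum whose component in
      \<open>V k\<close> is nonzero.\<close>
    let ?u = "u(V k := - x)" and ?F = "insert (V k) F"
    have kF: "V k \<notin> F" using k F(3) by blast
    have ds: "direct_sum (range V) (\<lambda>W. W) X"
      using decomposition_V unfolding irreducible_decomposition_def by blast
    have "(\<Sum>W\<in>?F. ?u W) = - x + (\<Sum>W\<in>F. ?u W)"
      unfolding sum.insert[OF F(2) kF] by simp
    also have "(\<Sum>W\<in>F. ?u W) = x" unfolding F(1) by (rule sum.cong) (use kF in auto)
    finally have "(\<Sum>W\<in>?F. ?u W) = 0" by (simp only: ab_left_minus)
    moreover have "finite ?F" "?F \<subseteq> range V" using F(2,3) sub by auto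
    moreover have "\<forall>W\<in>?F. ?u W \<in> W"
      using F(4) kF fs.subspace_neg[OF subspace_V x(1)] by auto
    ultimately have "?u (V k) = 0" using direct_sum_independent[OF ds, of ?F ?u "V k"] by blast
    then have "- x = 0" by simp
    then show False using x(2) by (simp only: neg_equal_0_iff_equal)
  qed
qed

end

subsection \<open>The zeta function\<close>

text \<open>Complex powers are not multiplicative in the base in general; they are for nonnegative
  real bases.\<close>

lemma of_nat_mult_powr:
  "of_nat (a * b) powr z = (of_nat a powr z * of_nat b powr z :: complex)"
  by (simp add: powr_times_real)

lemma of_nat_prod_powr:
  fixes f :: "nat \<Rightarrow> nat"
  shows "of_nat (\<Prod>j=1..n. f j) powr z = (\<Prod>j=1..n. of_nat (f j) powr z :: complex)"
proof (induction n)
  case (Suc n)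
  have "(\<Prod>j=1..Suc n. f j) = (\<Prod>j=1..n. f j) * f (Suc n)" by simp
  then show ?case using Suc by (simp only: of_nat_mult_powr) simp
qed simp

context boundary_transitive
begin

text \<open>Exponential growth of the dimensions yields convergence for every positive real
  part.\<close>

lemma dim_V_Suc_ge: "2 ^ n \<le> fs.dim (V (Suc n))"
proof -
  have "2 ^ n \<le> (\<Prod>j=1..n. m j)"
  proof (induction n)
    case (Suc n)
    then show ?case using mult_le_mono[OF Suc branching[of "Suc n"]] by (simp add: mult.commute)
  qed simp
  moreover have "1 \<le> m (Suc n) - 1" using branching[of "Suc n"] by simp
  ultimately show ?thesis unfolding dim_V_Suc using mult_le_mono[of 1 "m (Suc n) - 1"] by force
qed

lemma dim_V_pos: "0 < fs.dim (V n)"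
proof (cases n)
  case (Suc k)
  then show ?thesis using dim_V_Suc_ge[of k] by (metis less_le_trans pos2 zero_less_power)
qed (simp add: dim_V_0)

lemma dim_V_ge: "n \<le> fs.dim (V n)"
proof (cases n)
  case (Suc k)
  have "Suc k \<le> 2 ^ k" using less_exp[of k] by (rule Suc_leI)
  then show ?thesis using dim_V_Suc_ge[of k] Suc by simp
qed simp

text \<open>With \<open>P\<close> the product up to \<open>n\<close>, compare both dimensions with
  \<open>m (Suc n) * P\<close>. The sequence starts at \<open>V 1\<close> because \<open>V 0\<close>
  and \<open>V 1\<close> are both lines when \<open>m 1 = 2\<close>.\<close>

lemma strict_mono_dim_V_Suc: "strict_mono (\<lambda>n. fs.dim (V (Suc n)))"
  unfolding strict_mono_Suc_iff
proof
  fix n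
  let ?P = "\<Prod>j=1..n. m j"
  have "?P > 0" using branching by (intro prod_pos) (metis atLeastAtMost_iff less_le_trans pos2)
  moreover have "m (Suc n) - 1 < m (Suc n)" using branching[of "Suc n"] by simp
  ultimately have "(m (Suc n) - 1) * ?P < m (Suc n) * ?P" by (rule mult_less_mono1[rotated])
  also have "\<dots> \<le> (m (Suc (Suc n)) - 1) * (m (Suc n) * ?P)"
  proof -
    have "1 \<le> m (Suc (Suc n)) - 1" using branching[of "Suc (Suc n)"] by simp
    then show ?thesis using mult_le_mono1[of 1 _ "m (Suc n) * ?P"] by simp
  qed
  finally show "fs.dim (V (Suc n)) < fs.dim (V (Suc (Suc n)))"
    unfolding dim_V_Suc by (simp add: mult.commute)
qed

lemma strongly_admissible_rho: "strongly_admissible G T \<rho>"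
proof -
  have "finite {W \<in> range V. fs.dim W = d}" for d
  proof (rule finite_subset)
    show "{W \<in> range V. fs.dim W = d} \<subseteq> V ` {..d}" using dim_V_ge by auto
  qed simp
  then show ?thesis
    unfolding strongly_admissible_def using smooth_rho decomposition_V by blast
qed

text \<open>Nontriviality rules out \<open>V 0\<close>, which the dimension alone cannot separate
  from \<open>V 1\<close> when \<open>m 1 = 2\<close>; beyond that dimensions increase
  strictly.\<close>

lemma irreducible_nontrivial_eq_V:
  assumes W: "irreducible_subrep G \<rho> W" "\<not> trivial_rep G (restrict_rep \<rho> W)"
    and dim: "fs.dim W = fs.dim (V (Suc n))"
  shows "W = V (Suc n)"
proof -
  obtain k where k: "W = V k" using irreducible_subrep_cases[OF W(1)] .
  then obtain l where l: "k = Suc l" using W(2) trivial_V_0 by (cases k) auto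
  have "l = n"
    using dim strict_mono_eq[OF strict_mono_dim_V_Suc] unfolding k l by simp
  then show ?thesis using k l by simp
qed

text \<open>\<open>range V\<close> is the only decomposition, and its members are pairwise
  non-isomorphic, so the count is at most 1.\<close>

lemma multiplicity_rho:
  assumes \<pi>: "is_rep G \<pi>"
  shows "multiplicity_rep G \<pi> \<rho> = (if \<exists>n. iso_rep G \<pi> (restrict_rep \<rho> (V n)) then 1 else 0)"
proof -
  let ?S = "{W \<in> range V. iso_rep G \<pi> (restrict_rep \<rho> W)}"
  have S: "finite ?S \<and> card ?S = (if \<exists>n. iso_rep G \<pi> (restrict_rep \<rho> (V n)) then 1 else 0)"
  proof (cases "\<exists>n. iso_rep G \<pi> (restrict_rep \<rho> (V n))")
    case True
    then obtain n where n: "iso_rep G \<pi> (restrict_rep \<rho> (V n))" by blast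
    have "k = n" if "iso_rep G \<pi> (restrict_rep \<rho> (V k))" for k
      by (rule iso_V_imp_eq[OF iso_rep_trans[OF iso_rep_sym[OF \<pi> that] n]])
    then have "?S = {V n}" using n by blast
    then show ?thesis using True by simp
  next
    case False
    then have "?S = {}" by blast
    then show ?thesis unfolding if_not_P[OF False] by (simp only: finite.emptyI card.empty)
  qed
  show ?thesis
    unfolding multiplicity_rep_def
  proof (rule the_equality)
    show "\<forall>D. irreducible_decomposition G \<rho> D \<longrightarrow>
        finite {W \<in> D. iso_rep G \<pi> (restrict_rep \<rho> W)} \<and>
        card {W \<in> D. iso_rep G \<pi> (restrict_rep \<rho> W)} =
          (if \<exists>n. iso_rep G \<pi> (restrict_rep \<rho> (V n)) then 1 else 0)"
      using decomposition_unique S by blast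
    fix k
    assume "\<forall>D. irreducible_decomposition G \<rho> D \<longrightarrow>
        finite {W \<in> D. iso_rep G \<pi> (restrict_rep \<rho> W)} \<and>
        card {W \<in> D. iso_rep G \<pi> (restrict_rep \<rho> W)} = k"
    then have "card ?S = k" using decomposition_V by blast
    then show "k = (if \<exists>n. iso_rep G \<pi> (restrict_rep \<rho> (V n)) then 1 else 0)" using S by simp
  qed
qed

lemma smooth_irreps_is_rep: "\<pi> \<in> smooth_irreps G T \<Longrightarrow> is_rep G \<pi>"
  by (simp add: smooth_irreps_def smooth_rep_def)

lemma multiplicity_free_rho: "multiplicity_free G T \<rho>"
  unfolding multiplicity_free_def using multiplicity_rho[OF smooth_irreps_is_rep] by simp

lemma V_smooth_irrep: "restrict_rep \<rho> (V n) \<in> smooth_irreps G T"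
  using irreducible_V[of n] smooth_sub[OF invariantD[OF invariant_V[of n]]]
  by (simp add: smooth_irreps_def irreducible_subrep_def)

definition V_class :: "nat \<Rightarrow> (nat list \<Rightarrow> nat list, nat list \<Rightarrow> nat list) rep set" where
  "V_class n = {\<pi> \<in> smooth_irreps G T. iso_rep G (restrict_rep \<rho> (V n)) \<pi>}"

lemma irrep_classes_eq:
  "irrep_classes G T = (\<lambda>\<pi>. {\<pi>' \<in> smooth_irreps G T. iso_rep G \<pi> \<pi>'}) ` smooth_irreps G T"
  by (auto simp: irrep_classes_def quotient_def)

lemma V_class_in_classes: "V_class n \<in> irrep_classes G T"
  unfolding irrep_classes_eq V_class_def using V_smooth_irrep by blast

lemma inj_V_class: "inj V_class"
proof (rule injI)
  fix a b assume "V_class a = V_class b"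
  moreover have "restrict_rep \<rho> (V b) \<in> V_class b"
    using V_smooth_irrep iso_rep_refl by (auto simp: V_class_def)
  ultimately have "iso_rep G (restrict_rep \<rho> (V a)) (restrict_rep \<rho> (V b))"
    by (auto simp: V_class_def)
  then show "a = b" by (rule iso_V_imp_eq)
qed

lemma zeta_term_V_class: "zeta_term G \<rho> s (V_class n) = of_nat (fs.dim (V n)) powr (- s)"
proof -
  \<comment> \<open>The chosen representative need not be \<open>V n\<close> itself; multiplicity
    and dimension are carried over by the isomorphism.\<close>
  let ?\<pi> = "SOME \<pi>. \<pi> \<in> V_class n"
  have "?\<pi> \<in> V_class n"
    by (rule someI[of _ "restrict_rep \<rho> (V n)"]) (simp add: V_class_def V_smooth_irrep iso_rep_refl)
  then have \<pi>: "is_rep G ?\<pi>" "iso_rep G (restrict_rep \<rho> (V n)) ?\<pi>"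
    using smooth_irreps_is_rep by (simp_all add: V_class_def)
  have "iso_rep G ?\<pi> (restrict_rep \<rho> (V n))" by (rule iso_rep_sym[OF is_rep_V \<pi>(2)])
  then have "multiplicity_rep G ?\<pi> \<rho> = 1" using multiplicity_rho[OF \<pi>(1)] by auto
  moreover have "fs.dim (rspace ?\<pi>) = fs.dim (V n)"
  proof -
    obtain \<phi> where \<phi>: "linear_between (V n) (rspace ?\<pi>) \<phi>" "bij_betw \<phi> (V n) (rspace ?\<pi>)"
      using \<pi>(2) unfolding iso_rep_def by auto
    obtain B where B: "finite B" "B \<subseteq> V n" "fs.independent B" "V n \<subseteq> fs.span B"
      by (rule V_finite_basis)
    show ?thesis by (rule dim_eq_of_linear_bij[OF \<phi> subspace_V B])
  qed
  ultimately show ?thesis by (simp add: zeta_term_def Let_def)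
qed

text \<open>A representative isomorphic to some \<open>V n\<close> would force the class to be
  \<open>V_class n\<close>, so here the multiplicity is 0.\<close>

lemma zeta_term_eq_0:
  assumes C: "C \<in> irrep_classes G T" "C \<notin> range V_class"
  shows "zeta_term G \<rho> s C = 0"
proof -
  obtain \<pi> where \<pi>: "\<pi> \<in> smooth_irreps G T" "C = {\<pi>' \<in> smooth_irreps G T. iso_rep G \<pi> \<pi>'}"
    using C(1) unfolding irrep_classes_eq by blast
  let ?\<sigma> = "SOME \<pi>. \<pi> \<in> C"
  have "?\<sigma> \<in> C" by (rule someI[of _ \<pi>]) (simp add: \<pi> iso_rep_refl)
  then have \<sigma>: "is_rep G ?\<sigma>" "iso_rep G \<pi> ?\<sigma>"
    unfolding \<pi>(2) using smooth_irreps_is_rep by simp_all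
  have "\<not> iso_rep G ?\<sigma> (restrict_rep \<rho> (V n))" for n
  proof
    assume "iso_rep G ?\<sigma> (restrict_rep \<rho> (V n))"
    then have i: "iso_rep G \<pi> (restrict_rep \<rho> (V n))" by (rule iso_rep_trans[OF \<sigma>(2)])
    then have i': "iso_rep G (restrict_rep \<rho> (V n)) \<pi>"
      by (rule iso_rep_sym[OF smooth_irreps_is_rep[OF \<pi>(1)]])
    have "iso_rep G \<pi> \<pi>' \<longleftrightarrow> iso_rep G (restrict_rep \<rho> (V n)) \<pi>'"
      for \<pi>' :: "(nat list \<Rightarrow> nat list, nat list \<Rightarrow> nat list) rep"
      using iso_rep_trans[OF i] iso_rep_trans[OF i'] by blast
    then have "C = V_class n" unfolding \<pi>(2) V_class_def by simp
    then show False using C(2) by blast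
  qed
  then have "multiplicity_rep G ?\<sigma> \<rho> = 0" using multiplicity_rho[OF \<sigma>(1)] by simp
  then show ?thesis by (simp add: zeta_term_def Let_def)
qed

text \<open>Classes outside \<open>range V_class\<close> contribute 0, and the remaining ones are
  indexed injectively by the levels.\<close>

lemma has_sum_zeta_iff:
  "(zeta_term G \<rho> s has_sum z) (irrep_classes G T) \<longleftrightarrow>
     ((\<lambda>n. of_nat (fs.dim (V n)) powr (- s)) has_sum z) UNIV"
proof -
  have "(zeta_term G \<rho> s has_sum z) (irrep_classes G T) \<longleftrightarrow> (zeta_term G \<rho> s has_sum z) (range V_class)"
    by (rule has_sum_cong_neutral) (use zeta_term_eq_0 V_class_in_classes in auto)
  also have "\<dots> \<longleftrightarrow> (zeta_term G \<rho> s \<circ> V_class has_sum z) UNIV"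
    by (rule has_sum_reindex[OF inj_V_class])
  finally show ?thesis by (simp add: o_def zeta_term_V_class)
qed

section \<open>Convergence and the abscissa\<close>

lemma summable_dim_V_powr:
  assumes "Re s > 0"
  shows "summable (\<lambda>n. norm (of_nat (fs.dim (V n)) powr (- s) :: complex))"
proof -
  \<comment> \<open>From level 1 on the terms are dominated by a geometric series of this ratio,
    which is less than 1 since \<open>Re s\<close> is positive.\<close>
  let ?q = "2 powr (- Re s) :: real"
  have le: "norm (of_nat (fs.dim (V (Suc n))) powr (- s) :: complex) \<le> ?q ^ n" for n
  proof -
    have "norm (of_nat (fs.dim (V (Suc n))) powr (- s) :: complex) = real (fs.dim (V (Suc n))) powr (- Re s)"
      by (simp add: norm_powr_real_powr)
    also have "\<dots> \<le> (2 ^ n) powr (- Re s)"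
      using assms dim_V_Suc_ge[of n] by (intro powr_mono2') (simp_all flip: of_nat_le_iff)
    also have "\<dots> = ?q ^ n"
      by (simp add: powr_powr mult.commute flip: powr_realpow)
    finally show ?thesis .
  qed
  have "summable (\<lambda>n. ?q ^ n)"
    using assms by (intro summable_geometric) (simp add: powr_less_one)
  then have "summable (\<lambda>n. norm (of_nat (fs.dim (V (Suc n))) powr (- s) :: complex))"
    by (rule summable_comparison_test'[where N = 0]) (simp only: real_norm_def abs_norm_cancel le)
  then show ?thesis by (subst (asm) summable_Suc_iff)
qed

lemma zeta_converges_iff:
  "zeta_converges G T \<rho> s \<longleftrightarrow> (\<lambda>n. of_nat (fs.dim (V n)) powr (- s) :: complex) summable_on UNIV"
  unfolding zeta_converges_def summable_on_def has_sum_zeta_iff ..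

lemma zeta_converges_pos: "Re s > 0 \<Longrightarrow> zeta_converges G T \<rho> s"
  unfolding zeta_converges_iff by (rule norm_summable_imp_summable_on[OF summable_dim_V_powr])

text \<open>At 0 every term equals 1, so the terms do not tend to 0.\<close>

lemma not_zeta_converges_0: "\<not> zeta_converges G T \<rho> 0"
proof
  assume "zeta_converges G T \<rho> 0"
  then obtain z where "((\<lambda>n. of_nat (fs.dim (V n)) powr (- 0) :: complex) has_sum z) UNIV"
    unfolding zeta_converges_iff summable_on_def by blast
  then have "(\<lambda>n. of_nat (fs.dim (V n)) powr (- 0) :: complex) sums z" by (rule has_sum_imp_sums)
  then have "(\<lambda>n. of_nat (fs.dim (V n)) powr (- 0) :: complex) \<longlonglongrightarrow> 0"
    by (intro summable_LIMSEQ_zero sums_summable)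
  \<comment> \<open>Positivity of the dimension matters, since \<open>0 powr 0\<close> is 0.\<close>
  moreover have "(of_nat (fs.dim (V n)) powr (- 0) :: complex) = 1" for n
    using dim_V_pos[of n] by simp
  ultimately have "(\<lambda>n::nat. 1 :: complex) \<longlonglongrightarrow> 0" by simp
  then show False using LIMSEQ_unique[OF tendsto_const] by fastforce
qed

lemma zeta_sums:
  assumes "Re s > 0"
  shows "(\<lambda>i. of_nat (m (Suc i) - 1) powr (- s) * (\<Prod>j=1..i. of_nat (m j) powr (- s)))
         sums (zeta_rep G T \<rho> s - 1)"
proof -
  let ?a = "\<lambda>n. of_nat (fs.dim (V n)) powr (- s) :: complex"
  have "(zeta_term G \<rho> s has_sum zeta_rep G T \<rho> s) (irrep_classes G T)"
    using zeta_converges_pos[OF assms] unfolding zeta_converges_def zeta_rep_def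
    by (rule has_sum_infsum)
  then have "?a sums zeta_rep G T \<rho> s"
    unfolding has_sum_zeta_iff by (rule has_sum_imp_sums)
  \<comment> \<open>Splits off the term of the trivial constituent, which is the leading 1 of the
    zeta function.\<close>
  then have "(\<lambda>i. ?a (Suc i)) sums (zeta_rep G T \<rho> s - ?a 0)"
    using sums_split_initial_segment[of ?a _ 1] by simp
  moreover have "?a 0 = 1" by (simp add: dim_V_0)
  moreover have "?a (Suc i) = of_nat (m (Suc i) - 1) powr (- s) * (\<Prod>j=1..i. of_nat (m j) powr (- s))" for i
    unfolding dim_V_Suc of_nat_mult_powr of_nat_prod_powr ..
  ultimately show ?thesis by (simp only:)
qed

lemma abscissa_rho: "abscissa_of_convergence G T \<rho> = 0"
  unfolding abscissa_of_convergence_def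
proof (rule antisym)
  have "(0::real) \<in> {\<sigma>::real. \<forall>s. Re s > \<sigma> \<longrightarrow> zeta_converges G T \<rho> s}"
    using zeta_converges_pos by simp
  then show "Inf (ereal ` {\<sigma>::real. \<forall>s. Re s > \<sigma> \<longrightarrow> zeta_converges G T \<rho> s}) \<le> 0"
    by (metis (no_types, lifting) Inf_lower imageI zero_ereal_def)
  show "0 \<le> Inf (ereal ` {\<sigma>::real. \<forall>s. Re s > \<sigma> \<longrightarrow> zeta_converges G T \<rho> s})"
  proof (rule Inf_greatest)
    fix x assume "x \<in> ereal ` {\<sigma>::real. \<forall>s. Re s > \<sigma> \<longrightarrow> zeta_converges G T \<rho> s}"
    then obtain \<sigma> where \<sigma>: "x = ereal \<sigma>" "\<forall>s. Re s > \<sigma> \<longrightarrow> zeta_converges G T \<rho> s" by blast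
    \<comment> \<open>For negative \<sigma> the point 0, where the series diverges, would lie in the
      half-plane of convergence.\<close>
    have "\<not> Re 0 > \<sigma>" using \<sigma>(2) not_zeta_converges_0 by blast
    then show "0 \<le> x" using \<sigma>(1) by simp
  qed
qed

end

theorem theoremE:
  fixes m :: "nat \<Rightarrow> nat" and H :: "(nat list \<Rightarrow> nat list) set" and \<xi> :: "nat \<Rightarrow> nat"
  assumes "\<forall>n\<ge>1. m n \<ge> 2"
    and "subgroup H (AutT m)"
    and "closedin (aut_top m) H"
    and "distance_transitive H (boundary m) bdist bact"
    and "\<xi> \<in> boundary m"
  defines "G \<equiv> (AutT m)\<lparr>carrier := H\<rparr>"
    and "T \<equiv> subtopology (aut_top m) H"
  defines "\<rho> \<equiv> induced_trivial G T (point_stabiliser H \<xi>)"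
  shows "strongly_admissible G T \<rho> \<and>
    (\<exists>V :: nat \<Rightarrow> ((nat list \<Rightarrow> nat list) \<Rightarrow> complex) set.
       direct_sum UNIV V (rspace \<rho>) \<and>
       invariant G \<rho> (V 0) \<and> trivial_rep G (restrict_rep \<rho> (V 0)) \<and>
       (\<forall>n\<ge>1. irreducible_subrep G \<rho> (V n) \<and>
          fs.dim (V n) = (m n - 1) * (\<Prod>j=1..n-1. m j) \<and>
          (\<forall>W. irreducible_subrep G \<rho> W \<and> \<not> trivial_rep G (restrict_rep \<rho> W) \<and>
             fs.dim W = (m n - 1) * (\<Prod>j=1..n-1. m j) \<longrightarrow> W = V n))) \<and>
    multiplicity_free G T \<rho> \<and>
    (\<forall>s. Re s > 0 \<longrightarrow>
       zeta_converges G T \<rho> s \<and>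
       (\<lambda>i. of_nat (m (Suc i) - 1) powr (- s) * (\<Prod>j=1..i. of_nat (m j) powr (- s)))
         sums (zeta_rep G T \<rho> s - 1)) \<and>
    abscissa_of_convergence G T \<rho> = 0"
proof -
  interpret B: boundary_transitive m H \<xi>
    by (rule boundary_transitive.intro) (use assms(1-5) in blast)+
  have dim: "fs.dim (B.V n) = (m n - 1) * (\<Prod>j=1..n-1. m j)" if "n \<ge> 1" for n
    using that B.dim_V_Suc[of "n - 1"] by simp
  show ?thesis
  proof (intro conjI exI[of _ B.V] allI impI)
    show "strongly_admissible G T \<rho>" "direct_sum UNIV B.V (rspace \<rho>)" "invariant G \<rho> (B.V 0)"
      "trivial_rep G (restrict_rep \<rho> (B.V 0))" "multiplicity_free G T \<rho>"
      "abscissa_of_convergence G T \<rho> = 0"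
      unfolding \<rho>_def G_def T_def
      by (fact B.strongly_admissible_rho B.direct_sum_V B.invariant_V B.trivial_V_0
          B.multiplicity_free_rho B.abscissa_rho)+
  next
    fix n :: nat assume n: "1 \<le> n"
    show "irreducible_subrep G \<rho> (B.V n)"
      unfolding \<rho>_def G_def T_def by (rule B.irreducible_V)
    show "fs.dim (B.V n) = (m n - 1) * (\<Prod>j=1..n-1. m j)" using n by (rule dim)
    fix W
    assume W: "irreducible_subrep G \<rho> W \<and> \<not> trivial_rep G (restrict_rep \<rho> W) \<and>
      fs.dim W = (m n - 1) * (\<Prod>j=1..n-1. m j)"
    then have "fs.dim W = fs.dim (B.V (Suc (n - 1)))" using n dim[OF n] by simp
    then show "W = B.V n"
      using W n B.irreducible_nontrivial_eq_V[of W "n - 1"] unfolding \<rho>_def G_def T_def by simp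
  next
    fix s :: complex assume s: "0 < Re s"
    show "zeta_converges G T \<rho> s" unfolding \<rho>_def G_def T_def by (rule B.zeta_converges_pos[OF s])
    show "(\<lambda>i. of_nat (m (Suc i) - 1) powr (- s) * (\<Prod>j=1..i. of_nat (m j) powr (- s)))
         sums (zeta_rep G T \<rho> s - 1)"
      unfolding \<rho>_def G_def T_def by (rule B.zeta_sums[OF s])
  qed
qed

end
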